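(* Let $G$ be a graph consisting of $p$ internally disjoint paths between two vertices $u$ and $v$ (all other vertices having degree $2$), drawn in the plane without crossings with $u$ the leftmost and $v$ the rightmost vertex, such that the drawing is symmetric under reflection in a vertical line (which interchanges $u$ and $v$ and maps each of the $p$ paths to itself). Suppose every one of the $p$ paths having an odd number of edges has at least $5$ edges. Then in the Game of Cycles on $G$, Player 1 has a winning strategy when $G$ has an odd number of edges, and Player 2 has a winning strategy when $G$ has an even number of edges.
   Context: Game of Cycles: the gameboard is a simple connected graph drawn in the plane without crossings. Players 1 and 2 alternate turns, Player 1 first; on a turn a player must, if possible, direct one currently undirected edge, and it is illegal to create a sink (a vertex all of whose incident edges point into it) or a source (a vertex all of whose incident edges point out of it). A cycle cell is a cycle of the graph bounding a bounded face of the drawing (here, the cycle formed by two paths that are consecutive in the drawing); a player who directs an edge so that all edges of some cycle cell are directed consistently around it wins immediately. Otherwise the player who makes the last legal move wins. *)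

theory Defs
  imports "Graph_Theory.Graph_Theory" "HOL-Analysis.Analysis"
begin

section \<open>Plane drawings and cycle cells\<close>

text \<open>A simple graph is a \<^const>\<open>pair_graph\<close>: a finite, symmetric, loop-free set of
  arcs on pairs.  One undirected edge \<open>{x, y}\<close> therefore corresponds to the two arcs
  \<open>(x, y)\<close> and \<open>(y, x)\<close>, and each of these arcs is one of the two ways of directing the edge.\<close>

definition uedge :: "'v \<times> 'v \<Rightarrow> 'v set" where
  "uedge a = {fst a, snd a}"

definition uedges :: "'v pair_pre_digraph \<Rightarrow> 'v set set" where
  "uedges G = uedge ` parcs G"

definition plane_drawing ::
  "'v pair_pre_digraph \<Rightarrow> ('v \<Rightarrow> complex) \<Rightarrow> ('v set \<Rightarrow> real \<Rightarrow> complex) \<Rightarrow> bool" where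
  "plane_drawing G pos curve \<longleftrightarrow>
     inj_on pos (pverts G) \<and>
     (\<forall>e\<in>uedges G. Path_Connected.arc (curve e) \<and>
        {pathstart (curve e), pathfinish (curve e)} = pos ` e \<and>
        path_image (curve e) \<inter> pos ` pverts G = pos ` e) \<and>
     (\<forall>e\<in>uedges G. \<forall>f\<in>uedges G. e \<noteq> f \<longrightarrow>
        path_image (curve e) \<inter> path_image (curve f) = pos ` (e \<inter> f))"

definition drawn_walk :: "('v set \<Rightarrow> real \<Rightarrow> complex) \<Rightarrow> ('v \<times> 'v) list \<Rightarrow> complex set" where
  "drawn_walk curve P = (\<Union>a\<in>set P. path_image (curve (uedge a)))"

definition drawn_graph ::
  "'v pair_pre_digraph \<Rightarrow> ('v \<Rightarrow> complex) \<Rightarrow> ('v set \<Rightarrow> real \<Rightarrow> complex) \<Rightarrow> complex set" where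
  "drawn_graph G pos curve = pos ` pverts G \<union> (\<Union>e\<in>uedges G. path_image (curve e))"

text \<open>The faces are the connected components of the complement of the drawing.  The length
  condition excludes the closed walks \<open>[(x, y), (y, x)]\<close>, which use one edge twice but are
  cycles of the symmetric digraph.  A cell occurs here once for every starting vertex and for
  each of its two directions.\<close>

definition cycle_cells ::
  "'v pair_pre_digraph \<Rightarrow> ('v \<Rightarrow> complex) \<Rightarrow> ('v set \<Rightarrow> real \<Rightarrow> complex) \<Rightarrow> ('v \<times> 'v) list set" where
  "cycle_cells G pos curve =
     {c. pre_digraph.cycle (with_proj G) c \<and> 3 \<le> length c \<and>
         (\<exists>F\<in>components (- drawn_graph G pos curve).
            bounded F \<and> frontier F = drawn_walk curve c)}"

text \<open>The reflection in the vertical line \<open>{z. Re z = a}\<close>.\<close>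

definition reflection :: "real \<Rightarrow> complex \<Rightarrow> complex" where
  "reflection a z = Complex (2 * a - Re z) (Im z)"

definition symmetric_drawing ::
  "real \<Rightarrow> 'v pair_pre_digraph \<Rightarrow> ('v \<Rightarrow> complex) \<Rightarrow> ('v set \<Rightarrow> real \<Rightarrow> complex) \<Rightarrow> bool" where
  "symmetric_drawing a G pos curve \<longleftrightarrow>
     reflection a ` pos ` pverts G = pos ` pverts G \<and>
     (\<forall>e\<in>uedges G. \<exists>f\<in>uedges G. reflection a ` path_image (curve e) = path_image (curve f))"


section \<open>Internally disjoint paths between two vertices\<close>

definition union_of_disjoint_paths ::
  "'v pair_pre_digraph \<Rightarrow> 'v \<Rightarrow> 'v \<Rightarrow> ('v \<times> 'v) list set \<Rightarrow> bool" where
  "union_of_disjoint_paths G u v Ps \<longleftrightarrow>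
     u \<noteq> v \<and> finite Ps \<and> Ps \<noteq> {} \<and>
     (\<forall>P\<in>Ps. pre_digraph.apath (with_proj G) u P v) \<and>
     (\<forall>P\<in>Ps. \<forall>Q\<in>Ps. P \<noteq> Q \<longrightarrow>
        set (pawalk_verts u P) \<inter> set (pawalk_verts u Q) = {u, v}) \<and>
     pverts G = (\<Union>P\<in>Ps. set (pawalk_verts u P)) \<and>
     uedges G = (\<Union>P\<in>Ps. uedge ` set P) \<and>
     (\<forall>w\<in>pverts G - {u, v}. out_degree (with_proj G) w = 2)"


section \<open>The Game of Cycles\<close>

text \<open>A position is the set of arcs chosen so far.\<close>

definition is_sink :: "'v pair_pre_digraph \<Rightarrow> ('v \<times> 'v) set \<Rightarrow> 'v \<Rightarrow> bool" where
  "is_sink G D w \<longleftrightarrow> (\<forall>x. (x, w) \<in> parcs G \<longrightarrow> (x, w) \<in> D)"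

definition is_source :: "'v pair_pre_digraph \<Rightarrow> ('v \<times> 'v) set \<Rightarrow> 'v \<Rightarrow> bool" where
  "is_source G D w \<longleftrightarrow> (\<forall>x. (w, x) \<in> parcs G \<longrightarrow> (w, x) \<in> D)"

definition legal_move :: "'v pair_pre_digraph \<Rightarrow> ('v \<times> 'v) set \<Rightarrow> 'v \<times> 'v \<Rightarrow> bool" where
  "legal_move G D a \<longleftrightarrow>
     a \<in> parcs G \<and> a \<notin> D \<and> prod.swap a \<notin> D \<and>
     (\<forall>w\<in>pverts G. \<not> is_sink G (insert a D) w \<and> \<not> is_source G (insert a D) w)"

text \<open>In what follows \<open>C\<close> is the set of cycle cells, given as directed cycles.\<close>

definition cell_completed :: "('v \<times> 'v) list set \<Rightarrow> ('v \<times> 'v) set \<Rightarrow> bool" where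
  "cell_completed C D \<longleftrightarrow> (\<exists>c\<in>C. set c \<subseteq> D)"

definition game_over :: "'v pair_pre_digraph \<Rightarrow> ('v \<times> 'v) list set \<Rightarrow> ('v \<times> 'v) set \<Rightarrow> bool" where
  "game_over G C D \<longleftrightarrow> cell_completed C D \<or> (\<nexists>a. legal_move G D a)"

text \<open>A play is recorded as the list of its moves, in chronological order.\<close>

inductive play :: "'v pair_pre_digraph \<Rightarrow> ('v \<times> 'v) list set \<Rightarrow> ('v \<times> 'v) list \<Rightarrow> bool"
  for G C where
  play_Nil: "play G C []"
| play_snoc: "play G C h \<Longrightarrow> \<not> game_over G C (set h) \<Longrightarrow> legal_move G (set h) a
    \<Longrightarrow> play G C (h @ [a])"

datatype player = Player1 | Player2

definition to_move :: "('v \<times> 'v) list \<Rightarrow> player" where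
  "to_move h = (if even (length h) then Player1 else Player2)"

text \<open>The winner of a finished play is the player who made its last move: either that move
  completed a cycle cell, or no cell was completed and it was the last legal move.  If no
  move is possible at all, Player 1 cannot move and Player 2 wins.\<close>

definition winner :: "('v \<times> 'v) list \<Rightarrow> player" where
  "winner h = (if odd (length h) then Player1 else Player2)"

definition follows_strategy ::
  "player \<Rightarrow> (('v \<times> 'v) list \<Rightarrow> 'v \<times> 'v) \<Rightarrow> ('v \<times> 'v) list \<Rightarrow> bool" where
  "follows_strategy X s h \<longleftrightarrow>
     (\<forall>i<length h. to_move (take i h) = X \<longrightarrow> h ! i = s (take i h))"

text \<open>Plays cannot go on forever, since every move directs a new edge.\<close>

definition winning_strategy ::
  "'v pair_pre_digraph \<Rightarrow> ('v \<times> 'v) list set \<Rightarrow> player \<Rightarrow> (('v \<times> 'v) list \<Rightarrow> 'v \<times> 'v) \<Rightarrow> bool" where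
  "winning_strategy G C X s \<longleftrightarrow>
     (\<forall>h. play G C h \<and> follows_strategy X s h \<longrightarrow>
        (if game_over G C (set h) then winner h = X
         else to_move h = X \<longrightarrow> legal_move G (set h) (s h)))"

definition has_winning_strategy ::
  "'v pair_pre_digraph \<Rightarrow> ('v \<times> 'v) list set \<Rightarrow> player \<Rightarrow> bool" where
  "has_winning_strategy G C X \<longleftrightarrow> (\<exists>s. winning_strategy G C X s)"

end

theory Submission
  imports Defs
begin

text \<open>The geometry plays no role: a cell is a cycle, hence one path directed from \<open>u\<close> to \<open>v\<close>
  together with one directed from \<open>v\<close> to \<open>u\<close>.  An inner vertex has degree 2, so adjacent edges of a
  path are never directed oppositely.

  The player who wants the number of open edges to be even whenever the opponent is to move (after
  an opening move on a middle edge, if the number of edges is odd) answers a move on a path with the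
  mirror image of that edge, directed the same way with respect to \<open>u\<close> and \<open>v\<close>, and a middle edge
  with another middle edge.  If an odd path has just three open edges \<open>e\<close>, its mirror image \<open>e'\<close> and
  the middle edge \<open>m\<close>, and the opponent directs \<open>e\<close>, then answering with \<open>e'\<close> could leave the opponent
  a cell to complete with \<open>m\<close>.  As the path has at least five edges, both \<open>e'\<close> and \<open>m\<close> are now forced
  to follow \<open>e\<close>; they become a pair of answers to each other, and the player directs the middle
  edge of another odd path instead, of which there is one by parity.  This way no path ever has
  exactly one open edge when the opponent moves, so the opponent completes no cell.

  An answer can only be illegal at \<open>u\<close> or \<open>v\<close>.  In that case the directions at that vertex are so
  one-sided that no cell can be completed any more, and counting direction changes along the paths
  shows that an even number of edges stays open at the end, so that arbitrary moves win.\<close>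

section \<open>Directing the edges of a bundle of paths\<close>

text \<open>A position assigns to the \<open>i\<close>-th edge of a path \<open>None\<close> if it is open, and otherwise
  whether it points from \<open>u\<close> to \<open>v\<close>.\<close>

locale path_bundle =
  fixes Ps :: "'p set" and len :: "'p \<Rightarrow> nat"
  assumes finite_Ps: "finite Ps"
    and len_ge_2: "P \<in> Ps \<Longrightarrow> 2 \<le> len P"
    and odd_len_ge_5: "P \<in> Ps \<Longrightarrow> odd (len P) \<Longrightarrow> 5 \<le> len P"
begin

definition mirror :: "'p \<Rightarrow> nat \<Rightarrow> nat" where
  "mirror P i = len P - 1 - i"

abbreviation mid :: "'p \<Rightarrow> nat" where
  "mid P \<equiv> len P div 2"

text \<open>The flag selects the end of the bundle: \<open>True\<close> for \<open>u\<close>, \<open>False\<close> for \<open>v\<close>.\<close>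

definition first_edge :: "bool \<Rightarrow> 'p \<Rightarrow> nat" where
  "first_edge b P = (if b then 0 else len P - 1)"

definition second_edge :: "bool \<Rightarrow> 'p \<Rightarrow> nat" where
  "second_edge b P = (if b then 1 else len P - 2)"

text \<open>The first clause concerns the inner vertices, the second \<open>u\<close> and
  \<open>v\<close>. Since directions are measured from \<open>u\<close> to \<open>v\<close>, letting
  \<open>d\<close> range over both values covers sinks and sources at either end.\<close>

definition valid :: "('p \<Rightarrow> nat \<Rightarrow> bool option) \<Rightarrow> bool" where
  "valid s \<longleftrightarrow>
     (\<forall>P\<in>Ps. \<forall>i d. Suc i < len P \<longrightarrow> s P i = Some d \<longrightarrow> s P (Suc i) \<noteq> Some (\<not> d)) \<and>
     (\<forall>b d. \<exists>P\<in>Ps. s P (first_edge b P) \<noteq> Some d)"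

definition direct :: "('p \<Rightarrow> nat \<Rightarrow> bool option) \<Rightarrow> 'p \<Rightarrow> nat \<Rightarrow> bool \<Rightarrow> 'p \<Rightarrow> nat \<Rightarrow> bool option" where
  "direct s P i d = s(P := (s P)(i := Some d))"

definition can_direct :: "('p \<Rightarrow> nat \<Rightarrow> bool option) \<Rightarrow> 'p \<Rightarrow> nat \<Rightarrow> bool \<Rightarrow> bool" where
  "can_direct s P i d \<longleftrightarrow> P \<in> Ps \<and> i < len P \<and> s P i = None \<and> valid (direct s P i d)"

definition open_edges :: "('p \<Rightarrow> nat \<Rightarrow> bool option) \<Rightarrow> 'p \<Rightarrow> nat set" where
  "open_edges s P = {i. i < len P \<and> s P i = None}"

definition num_open :: "('p \<Rightarrow> nat \<Rightarrow> bool option) \<Rightarrow> nat" where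
  "num_open s = (\<Sum>P\<in>Ps. card (open_edges s P))"

definition all_directed :: "('p \<Rightarrow> nat \<Rightarrow> bool option) \<Rightarrow> 'p \<Rightarrow> bool \<Rightarrow> bool" where
  "all_directed s P d \<longleftrightarrow> (\<forall>i<len P. s P i = Some d)"

definition symmetric_path :: "('p \<Rightarrow> nat \<Rightarrow> bool option) \<Rightarrow> 'p \<Rightarrow> bool" where
  "symmetric_path s P \<longleftrightarrow> (\<forall>i<len P. s P (mirror P i) = s P i)"

definition mid_open :: "('p \<Rightarrow> nat \<Rightarrow> bool option) \<Rightarrow> 'p \<Rightarrow> bool" where
  "mid_open s P \<longleftrightarrow> odd (len P) \<and> s P (mid P) = None"

definition paired :: "('p \<Rightarrow> nat \<Rightarrow> bool option) \<Rightarrow> 'p \<Rightarrow> bool" where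
  "paired s P \<longleftrightarrow> symmetric_path s P \<and> \<not> mid_open s P"

definition free_mid :: "('p \<Rightarrow> nat \<Rightarrow> bool option) \<Rightarrow> 'p \<Rightarrow> bool" where
  "free_mid s P \<longleftrightarrow> symmetric_path s P \<and> mid_open s P \<and> (\<exists>i<len P. i \<noteq> mid P \<and> s P i = None)"

text \<open>In a hot path whoever directs one of the two open edges lets the other player direct the
  remaining one (unless it is blocked at \<open>u\<close> or \<open>v\<close>), so the two form a pair of replies.\<close>

definition hot :: "('p \<Rightarrow> nat \<Rightarrow> bool option) \<Rightarrow> 'p \<Rightarrow> nat \<Rightarrow> bool \<Rightarrow> bool" where
  "hot s P e d \<longleftrightarrow> odd (len P) \<and> e < len P \<and> e \<noteq> mid P \<and> s P (mid P) = None \<and> s P e = None \<and>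
     (\<forall>i<len P. i \<noteq> mid P \<longrightarrow> i \<noteq> e \<longrightarrow> s P i = Some d)"

text \<open>The parity clause lets free middle edges be used up two at a time: when a move of the
  opponent ends the freedom of one path, another free path remains to answer in.\<close>

definition balanced :: "('p \<Rightarrow> nat \<Rightarrow> bool option) \<Rightarrow> bool" where
  "balanced s \<longleftrightarrow> (\<forall>P\<in>Ps. paired s P \<or> free_mid s P \<or> (\<exists>e d. hot s P e d)) \<and>
     even (card {P \<in> Ps. free_mid s P})"

text \<open>Here \<open>A\<close> can no longer receive direction \<open>d\<close> at its far end, since that vertex would become
  a sink or a source.  No path can become directed entirely against \<open>d\<close> any more, so no cell
  will be completed, and the parity of the number of edges left open at the end is determined,
  whatever the players do.\<close>

definition locked :: "('p \<Rightarrow> nat \<Rightarrow> bool option) \<Rightarrow> 'p \<Rightarrow> bool \<Rightarrow> bool \<Rightarrow> bool" where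
  "locked s A d b \<longleftrightarrow> A \<in> Ps \<and> s A (first_edge b A) = Some d \<and>
     (\<forall>Z\<in>Ps - {A}. s Z (first_edge (\<not> b) Z) = Some d \<and>
        (s Z (first_edge b Z) = Some d \<or>
         s Z (first_edge b Z) = None \<and> s Z (second_edge b Z) = Some d))"

text \<open>The invariant of the positions in which the opponent of the winning player is to
  move.\<close>

definition good :: "('p \<Rightarrow> nat \<Rightarrow> bool option) \<Rightarrow> bool" where
  "good s \<longleftrightarrow> valid s \<and> even (num_open s) \<and> (balanced s \<or> (\<exists>A d b. locked s A d b))"

section \<open>Elementary facts on mirror images and on directing one edge\<close>

lemma direct_simps [simp]:
  "direct s P i d P i = Some d"
  "Q \<noteq> P \<Longrightarrow> direct s P i d Q = s Q"
  "j \<noteq> i \<Longrightarrow> direct s P i d P j = s P j"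
  by (auto simp: direct_def)

lemma direct_apply: "direct s P i d Q j = (if Q = P \<and> j = i then Some d else s Q j)"
  by (auto simp: direct_def)

lemma first_edge_less: "P \<in> Ps \<Longrightarrow> first_edge b P < len P"
  using len_ge_2[of P] by (auto simp: first_edge_def)

lemma second_edge_less: "P \<in> Ps \<Longrightarrow> second_edge b P < len P"
  using len_ge_2[of P] by (auto simp: second_edge_def)

lemma first_edge_neq: "P \<in> Ps \<Longrightarrow> first_edge b P \<noteq> first_edge (\<not> b) P"
  using len_ge_2[of P] by (auto simp: first_edge_def)

lemma second_edge_neq: "P \<in> Ps \<Longrightarrow> second_edge b P \<noteq> first_edge b P"
  using len_ge_2[of P] by (auto simp: first_edge_def second_edge_def)

lemma mirror_first_edge: "P \<in> Ps \<Longrightarrow> mirror P (first_edge b P) = first_edge (\<not> b) P"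
  using len_ge_2[of P] by (auto simp: first_edge_def mirror_def)

lemma mirror_less: "i < len P \<Longrightarrow> mirror P i < len P"
  by (auto simp: mirror_def)

lemma mirror_mirror: "i < len P \<Longrightarrow> mirror P (mirror P i) = i"
  by (auto simp: mirror_def)

lemma mirror_fixed: "i < len P \<Longrightarrow> mirror P i = i \<Longrightarrow> odd (len P) \<and> i = mid P"
  unfolding mirror_def by presburger

lemma mirror_mid: "odd (len P) \<Longrightarrow> mirror P (mid P) = mid P"
  unfolding mirror_def by presburger

lemma mid_less: "P \<in> Ps \<Longrightarrow> mid P < len P"
  using len_ge_2[of P] by auto

lemma mid_neq_first_edge: "P \<in> Ps \<Longrightarrow> odd (len P) \<Longrightarrow> mid P \<noteq> first_edge b P"
  using odd_len_ge_5[of P] by (auto simp: first_edge_def)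

lemma mirror_neq_mid: "i < len P \<Longrightarrow> odd (len P) \<Longrightarrow> i \<noteq> mid P \<Longrightarrow> mirror P i \<noteq> mid P"
  using mirror_mid mirror_mirror by metis

text \<open>In a valid position a move can only do harm next to the edge it directs: at the
  neighbours on the path, and at an end vertex it touches, where some other path must fail to carry
  \<open>d\<close>.\<close>

lemma can_direct_iff:
  assumes v: "valid s" and P: "P \<in> Ps" and i: "i < len P" and n: "s P i = None"
  shows "can_direct s P i d \<longleftrightarrow>
    (\<forall>j<len P. (j = Suc i \<or> i = Suc j) \<longrightarrow> s P j \<noteq> Some (\<not> d)) \<and>
    (\<forall>b. i = first_edge b P \<longrightarrow> (\<exists>Q\<in>Ps - {P}. s Q (first_edge b Q) \<noteq> Some d))" (is "_ \<longleftrightarrow> ?A \<and> ?B")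
proof -
  let ?s = "direct s P i d"
  have "(\<forall>Q\<in>Ps. \<forall>j e. Suc j < len Q \<longrightarrow> ?s Q j = Some e \<longrightarrow> ?s Q (Suc j) \<noteq> Some (\<not> e)) \<longleftrightarrow> ?A"
    (is "?L \<longleftrightarrow> _")
  proof
    assume L: ?L
    show ?A
    proof (intro allI impI)
      fix j assume j: "j < len P" and a: "j = Suc i \<or> i = Suc j"
      show "s P j \<noteq> Some (\<not> d)"
      proof (cases "j = Suc i")
        case True
        then show ?thesis using L P j by (force simp: direct_apply)
      next
        case False
        then have "i = Suc j" using a by auto
        then show ?thesis using L[rule_format, of P j "\<not> d"] P i by (auto simp: direct_apply)
      qed
    qed
  next
    assume A: ?A
    show ?L
    proof (intro ballI allI impI)
      fix Q j e assume Q: "Q \<in> Ps" and j: "Suc j < len Q" and e: "?s Q j = Some e"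
      have "s Q j = Some e \<Longrightarrow> s Q (Suc j) \<noteq> Some (\<not> e)"
        using v Q j unfolding valid_def by blast
      then show "?s Q (Suc j) \<noteq> Some (\<not> e)"
        using A[rule_format, of j] A[rule_format, of "Suc j"] j e
        by (cases e; cases d; auto simp: direct_apply split: if_splits)
    qed
  qed
  moreover have "(\<forall>b e. \<exists>Q\<in>Ps. ?s Q (first_edge b Q) \<noteq> Some e) \<longleftrightarrow> ?B" (is "?L \<longleftrightarrow> _")
  proof
    assume L: ?L
    show ?B
    proof (intro allI impI)
      fix b assume b: "i = first_edge b P"
      from L obtain Q where "Q \<in> Ps" "?s Q (first_edge b Q) \<noteq> Some d" by blast
      then show "\<exists>Q\<in>Ps - {P}. s Q (first_edge b Q) \<noteq> Some d"
        using b by (auto simp: direct_apply split: if_splits)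
    qed
  next
    assume B: ?B
    show ?L
    proof (intro allI)
      fix b e
      obtain Q where Q: "Q \<in> Ps" "s Q (first_edge b Q) \<noteq> Some e" using v unfolding valid_def by blast
      show "\<exists>Q\<in>Ps. ?s Q (first_edge b Q) \<noteq> Some e"
      proof (cases "i = first_edge b P \<and> e = d")
        case True
        then show ?thesis using B by (auto simp: direct_apply)
      next
        case False
        then show ?thesis using Q P by (cases "i = first_edge b P") (auto simp: direct_apply intro: bexI[of _ P] bexI[of _ Q])
      qed
    qed
  qed
  ultimately show ?thesis using P i n unfolding can_direct_def valid_def by blast
qed

lemma num_open_direct:
  assumes "can_direct s P i d"
  shows "num_open s = Suc (num_open (direct s P i d))"
proof -
  have P: "P \<in> Ps" and i: "i \<in> open_edges s P"
    using assms by (auto simp: can_direct_def open_edges_def)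
  have fin: "finite (open_edges s P)" by (auto simp: open_edges_def)
  have "open_edges (direct s P i d) P = open_edges s P - {i}"
    by (auto simp: open_edges_def direct_apply)
  then have "card (open_edges s P) = Suc (card (open_edges (direct s P i d) P))"
    using card_Suc_Diff1[OF fin i] by simp
  moreover have "(\<Sum>Q\<in>Ps - {P}. card (open_edges (direct s P i d) Q)) = (\<Sum>Q\<in>Ps - {P}. card (open_edges s Q))"
    by (rule sum.cong) (auto simp: open_edges_def)
  ultimately show ?thesis
    unfolding num_open_def by (simp add: sum.remove[OF finite_Ps P])
qed

text \<open>Once no move is left, open edges are exactly the places where the direction changes.\<close>

lemma segment_parity:
  fixes f :: "nat \<Rightarrow> bool option"
  assumes "a \<le> b" "f a = Some x" "f b = Some y"
    and "\<And>i d. a \<le> i \<Longrightarrow> i < b \<Longrightarrow> f i = Some d \<Longrightarrow> f (Suc i) \<noteq> Some (\<not> d)"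
    and "\<And>i d. a < i \<Longrightarrow> i < b \<Longrightarrow> f i = None \<Longrightarrow> f (i - 1) = Some (\<not> d) \<or> f (Suc i) = Some (\<not> d)"
  shows "even (card {i. a \<le> i \<and> i \<le> b \<and> f i = None}) \<longleftrightarrow> x = y"
  using assms
proof (induction b arbitrary: y rule: less_induct)
  case (less b)
  note IH = less.IH and prems = less.prems
  show ?case
  proof (cases "b = a")
    case True
    then have "{i. a \<le> i \<and> i \<le> b \<and> f i = None} = {}" using prems by auto
    moreover have "x = y" using prems True by auto
    ultimately show ?thesis by (metis card.empty even_zero)
  next
    case False
    then obtain c where b: "b = Suc c" and c: "a \<le> c" using prems(1) by (cases b) auto
    show ?thesis
    proof (cases "f c")
      case (Some z)
      have "{i. a \<le> i \<and> i \<le> b \<and> f i = None} = {i. a \<le> i \<and> i \<le> c \<and> f i = None}"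
        using b prems by (auto simp: le_Suc_eq)
      moreover have "z = y" using prems(4)[of c z] prems(3) c b Some by auto
      moreover have "even (card {i. a \<le> i \<and> i \<le> c \<and> f i = None}) \<longleftrightarrow> x = z"
        by (rule IH) (use prems b c Some in auto)
      ultimately show ?thesis by simp
    next
      case None
      then have "c \<noteq> a" using prems by auto
      then obtain e where e: "c = Suc e" "a \<le> e" using c by (cases c) auto
      \<comment> \<open>An open edge is blocked in both directions. For direction \<open>y\<close>
        the blocking neighbour cannot be \<open>b\<close>, which carries \<open>y\<close>, so it is
        \<open>e\<close>: a single open edge separates opposite directions.\<close>
      have fe: "f e = Some (\<not> y)" using prems(5)[of c y] prems(3) None b e by auto
      have eq: "{i. a \<le> i \<and> i \<le> b \<and> f i = None} = insert c {i. a \<le> i \<and> i \<le> e \<and> f i = None}"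
        using b e None prems by (auto simp: le_Suc_eq)
      have "even (card {i. a \<le> i \<and> i \<le> e \<and> f i = None}) \<longleftrightarrow> x = (\<not> y)"
        by (rule IH) (use prems b e fe in auto)
      moreover have "card (insert c {i. a \<le> i \<and> i \<le> e \<and> f i = None}) = Suc (card {i. a \<le> i \<and> i \<le> e \<and> f i = None})"
        by (rule card_insert_disjoint) (use e in auto)
      ultimately show ?thesis unfolding eq by auto
    qed
  qed
qed


section \<open>Mirror replies and what a blocked reply implies\<close>

lemma paired_mirror:
  assumes "symmetric_path s P" "can_direct s P i d" "i \<noteq> mid P \<or> even (len P)"
  shows "i \<noteq> mirror P i" "mirror P i < len P" "s P (mirror P i) = None"
    "direct s P i d P (mirror P i) = None"
proof -
  have i: "P \<in> Ps" "i < len P" "s P i = None" using assms(2) by (auto simp: can_direct_def)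
  show 1: "i \<noteq> mirror P i" using mirror_fixed[OF i(2)] assms(3) by metis
  show "mirror P i < len P" using mirror_less i by blast
  show "s P (mirror P i) = None" using assms(1) i by (simp add: symmetric_path_def)
  then show "direct s P i d P (mirror P i) = None" using 1 by (simp add: direct_apply)
qed

lemma mirror_reply:
  assumes v: "valid s" and sym: "symmetric_path s P" and c: "can_direct s P i d"
    and ni: "i \<noteq> mid P \<or> even (len P)"
  shows "can_direct (direct s P i d) P (mirror P i) d \<or>
    (\<exists>b. i = first_edge b P \<and> (\<forall>Z\<in>Ps - {P}. s Z (first_edge (\<not> b) Z) = Some d))"
proof -
  let ?s = "direct s P i d"
  have P: "P \<in> Ps" and i: "i < len P" "s P i = None" and vs: "valid ?s"
    using c by (auto simp: can_direct_def)
  note m = paired_mirror[OF sym c ni]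
  have adj: "\<forall>j<len P. (j = Suc (mirror P i) \<or> mirror P i = Suc j) \<longrightarrow> ?s P j \<noteq> Some (\<not> d)"
  proof (intro allI impI)
    fix j assume j: "j < len P" "j = Suc (mirror P i) \<or> mirror P i = Suc j"
    show "?s P j \<noteq> Some (\<not> d)"
    \<comment> \<open>\<open>j = i\<close> happens for the two central edges of a path of even
      length; there the edge just directed carries \<open>d\<close> itself.\<close>
    proof (cases "j = i")
      case False
      have "mirror P j = Suc i \<or> i = Suc (mirror P j)" using j i unfolding mirror_def by linarith
      then have "s P (mirror P j) \<noteq> Some (\<not> d)"
        using can_direct_iff[OF v P i, of d] c mirror_less[OF j(1)] by blast
      then show ?thesis using sym j False by (simp add: symmetric_path_def direct_apply)
    qed simp
  qed
  show ?thesis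
  proof (cases "\<exists>b. mirror P i = first_edge b P \<and> \<not> (\<exists>Q\<in>Ps - {P}. ?s Q (first_edge b Q) \<noteq> Some d)")
    case True
    then obtain b where b: "mirror P i = first_edge b P" "\<forall>Z\<in>Ps - {P}. s Z (first_edge b Z) = Some d" by auto
    have "i = first_edge (\<not> b) P" using b(1) mirror_mirror[OF i(1)] mirror_first_edge[OF P, of b] by simp
    then show ?thesis using b(2) by (intro disjI2 exI[of _ "\<not> b"]) simp
  next
    case False
    then show ?thesis using can_direct_iff[OF vs P m(2,4), of d] adj by blast
  qed
qed

text \<open>With at least five edges the middle edge is neither the first nor the second edge at
  either end, so among these only \<open>e\<close> can be open.\<close>

lemma hot_ends:
  assumes P: "P \<in> Ps" and h: "hot s P e d" and f: "s P (first_edge (\<not> b) P) = Some x"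
  shows "x = d" and "s P (first_edge b P) = Some d \<or>
         s P (first_edge b P) = None \<and> s P (second_edge b P) = Some d"
proof -
  have l: "odd (len P)" "5 \<le> len P" using h P odd_len_ge_5 by (auto simp: hot_def)
  have fm: "mid P \<noteq> first_edge b' P" for b' by (rule mid_neq_first_edge[OF P l(1)])
  have sm: "mid P \<noteq> second_edge b P" using l by (auto simp: second_edge_def)
  show "x = d" using h f fm first_edge_less[OF P] unfolding hot_def by (metis option.distinct(1) option.inject)
  show "s P (first_edge b P) = Some d \<or>
         s P (first_edge b P) = None \<and> s P (second_edge b P) = Some d"
    using h fm[of b] sm first_edge_less[OF P, of b] second_edge_less[OF P, of b] second_edge_neq[OF P, of b]
    unfolding hot_def by metis
qed

text \<open>Applies when an end vertex blocks the intended reply. What the other paths carry at that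
  far end passes to their near end: by reflection on symmetric paths, by \<open>hot_ends\<close> on
  hot ones, where the near edge may still be open.\<close>

lemma blocked_locked:
  assumes bal: "balanced s" and P: "P \<in> Ps" and d: "s' P (first_edge b P) = Some d"
    and others: "\<And>Z. Z \<noteq> P \<Longrightarrow> s' Z = s Z"
    and all: "\<forall>Z\<in>Ps - {P}. s Z (first_edge (\<not> b) Z) = Some d"
  shows "locked s' P d b"
  unfolding locked_def
proof (intro conjI ballI)
  fix Z assume Z: "Z \<in> Ps - {P}"
  then have far: "s Z (first_edge (\<not> b) Z) = Some d" using all by blast
  show "s' Z (first_edge (\<not> b) Z) = Some d" using far others Z by simp
  have "s Z (first_edge b Z) = Some d \<or> s Z (first_edge b Z) = None \<and> s Z (second_edge b Z) = Some d"
  proof (cases "symmetric_path s Z")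
    case True
    have "s Z (mirror Z (first_edge b Z)) = s Z (first_edge b Z)"
      using True first_edge_less Z unfolding symmetric_path_def by blast
    then show ?thesis using mirror_first_edge far Z by simp
  next
    case False
    then obtain e d' where h: "hot s Z e d'" using bal Z unfolding balanced_def paired_def free_mid_def by blast
    show ?thesis using hot_ends[OF _ h far] Z by blast
  qed
  then show "s' Z (first_edge b Z) = Some d \<or> s' Z (first_edge b Z) = None \<and> s' Z (second_edge b Z) = Some d"
    using others Z by simp
qed (use P d in auto)

text \<open>Directed edges never change, so only a move on an open near edge could spoil
  \<open>locked\<close>; its neighbour already carries \<open>d\<close> and forces \<open>d\<close>
  on it.\<close>

lemma locked_direct:
  assumes v: "valid s" and l: "locked s A d b" and c: "can_direct s P i x"
  shows "locked (direct s P i x) A d b"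
  unfolding locked_def
proof (intro conjI ballI)
  have P: "P \<in> Ps" and i: "i < len P" "s P i = None" using c by (auto simp: can_direct_def)
  have keep: "s Q j = Some y \<Longrightarrow> direct s P i x Q j = Some y" for Q j y
    using i by (auto simp: direct_apply)
  show "A \<in> Ps" "direct s P i x A (first_edge b A) = Some d" using l keep by (auto simp: locked_def)
  fix Z assume Z: "Z \<in> Ps - {A}"
  then have far: "s Z (first_edge (\<not> b) Z) = Some d" and
    near: "s Z (first_edge b Z) = Some d \<or> s Z (first_edge b Z) = None \<and> s Z (second_edge b Z) = Some d"
    using l by (auto simp: locked_def)
  show "direct s P i x Z (first_edge (\<not> b) Z) = Some d" using keep far by blast
  show "direct s P i x Z (first_edge b Z) = Some d \<or>
    direct s P i x Z (first_edge b Z) = None \<and> direct s P i x Z (second_edge b Z) = Some d"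
  proof (cases "s Z (first_edge b Z) = Some d")
    case True
    then show ?thesis using keep by blast
  next
    case False
    then have n: "s Z (first_edge b Z) = None" "s Z (second_edge b Z) = Some d" using near by auto
    show ?thesis
    proof (cases "P = Z \<and> i = first_edge b Z")
      case True
      have "second_edge b Z = Suc i \<or> i = Suc (second_edge b Z)"
        using True len_ge_2[OF P] by (auto simp: first_edge_def second_edge_def)
      then have "s Z (second_edge b Z) \<noteq> Some (\<not> x)"
        using can_direct_iff[OF v P i, of x] c True second_edge_less[OF P, of b] by blast
      then have "x = d" using n by auto
      then show ?thesis using True by simp
    next
      case False
      then show ?thesis using n keep by (auto simp: direct_apply)
    qed
  qed
qed

lemma locked_not_all_directed: "locked s A d b \<Longrightarrow> P \<in> Ps \<Longrightarrow> \<not> all_directed s P (\<not> d)"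
proof
  assume l: "locked s A d b" and P: "P \<in> Ps" and f: "all_directed s P (\<not> d)"
  have "s P (first_edge b' P) = Some (\<not> d)" for b'
    using f P first_edge_less by (auto simp: all_directed_def)
  then show False using l P unfolding locked_def
    by (metis Diff_iff option.inject singletonD)
qed

section \<open>Parity of the open edges when no move is left\<close>

lemma path_parity:
  assumes v: "valid s" and P: "P \<in> Ps" and t: "\<And>i x. \<not> can_direct s P i x"
    and ab: "a \<le> b" "b < len P" and fa: "s P a = Some x" and fb: "s P b = Some y"
  shows "even (card {i. a \<le> i \<and> i \<le> b \<and> s P i = None}) \<longleftrightarrow> x = y"
proof (rule segment_parity[OF ab(1) fa fb])
  fix i z assume "a \<le> i" "i < b" "s P i = Some z"
  then show "s P (Suc i) \<noteq> Some (\<not> z)" using v P ab unfolding valid_def by fastforce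
next
  fix i z assume i: "a < i" "i < b" "s P i = None"
  \<comment> \<open>An edge strictly between \<open>a\<close> and \<open>b\<close> touches neither
    \<open>u\<close> nor \<open>v\<close>, so only a neighbouring edge can block it.\<close>
  have "i \<noteq> first_edge c P" for c using i ab by (auto simp: first_edge_def)
  then obtain j where "j < len P" "j = Suc i \<or> i = Suc j" "s P j = Some (\<not> z)"
    using can_direct_iff[OF v P, of i z] t i ab by auto
  then show "s P (i - 1) = Some (\<not> z) \<or> s P (Suc i) = Some (\<not> z)" by auto
qed

text \<open>The segment from the second edge to the far edge carries \<open>d\<close> at both of its
  ends and so has an even number of open edges; the open near edge is one more.\<close>

lemma open_near_odd:
  assumes v: "valid s" and P: "P \<in> Ps" and t: "\<And>i x. \<not> can_direct s P i x"
    and n: "s P (first_edge b P) = None" and d: "s P (second_edge b P) = Some d"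
    and f: "s P (first_edge (\<not> b) P) = Some d"
  shows "odd (card (open_edges s P))"
proof -
  have l: "2 \<le> len P" by (rule len_ge_2[OF P])
  define lo hi :: nat where "lo = (if b then 1 else 0)" and "hi = (if b then len P - 1 else len P - 2)"
  have "lo \<le> hi" "hi < len P" "s P lo = Some d" "s P hi = Some d"
    using l d f by (cases b; simp add: lo_def hi_def first_edge_def second_edge_def)+
  then have "even (card {i. lo \<le> i \<and> i \<le> hi \<and> s P i = None})"
    using path_parity[OF v P t] by blast
  moreover have "open_edges s P = insert (first_edge b P) {i. lo \<le> i \<and> i \<le> hi \<and> s P i = None}"
    using n l by (cases b) (auto simp: open_edges_def lo_def hi_def first_edge_def intro: Nat.gr0I)
  moreover have "card (insert (first_edge b P) {i. lo \<le> i \<and> i \<le> hi \<and> s P i = None}) =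
    Suc (card {i. lo \<le> i \<and> i \<le> hi \<and> s P i = None})"
    by (rule card_insert_disjoint) (use l in \<open>auto simp: lo_def hi_def first_edge_def\<close>)
  ultimately show ?thesis by simp
qed

lemma ends_directed_parity:
  assumes v: "valid s" and P: "P \<in> Ps" and t: "\<And>i x. \<not> can_direct s P i x"
    and n: "s P (first_edge b P) = Some x" and f: "s P (first_edge (\<not> b) P) = Some y"
  shows "even (card (open_edges s P)) \<longleftrightarrow> x = y"
proof -
  have l: "2 \<le> len P" by (rule len_ge_2[OF P])
  have "open_edges s P = {i. 0 \<le> i \<and> i \<le> len P - 1 \<and> s P i = None}"
    using l by (auto simp: open_edges_def)
  moreover have "s P 0 = Some (if b then x else y)" "s P (len P - 1) = Some (if b then y else x)"
    using n f by (auto simp: first_edge_def split: if_splits)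
  moreover have "0 \<le> len P - 1" "len P - 1 < len P" using l by auto
  ultimately have "even (card (open_edges s P)) \<longleftrightarrow> (if b then x else y) = (if b then y else x)"
    using path_parity[OF v P t, of 0 "len P - 1"] by simp
  then show ?thesis by (auto split: if_splits)
qed

text \<open>Validity at the near end vertex yields a path \<open>Z\<close> with an open near edge.
  \<open>Z\<close> and \<open>A\<close> turn out to be the only paths with an odd number of open
  edges.\<close>

lemma locked_terminal:
  assumes v: "valid s" and l: "locked s A d b" and t: "\<And>P i x. \<not> can_direct s P i x"
  shows "even (num_open s)"
proof -
  have A: "A \<in> Ps" and dA: "s A (first_edge b A) = Some d" using l by (auto simp: locked_def)
  have far: "s Z (first_edge (\<not> b) Z) = Some d" and
    near: "s Z (first_edge b Z) = Some d \<or> s Z (first_edge b Z) = None \<and> s Z (second_edge b Z) = Some d"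
    if "Z \<in> Ps - {A}" for Z
    using l that by (auto simp: locked_def)
  have "\<exists>P\<in>Ps. s P (first_edge b P) \<noteq> Some d" using v unfolding valid_def by blast
  then obtain Z where Z: "Z \<in> Ps" "s Z (first_edge b Z) \<noteq> Some d" by blast
  then have ZA: "Z \<noteq> A" using dA by auto
  then have Zn: "s Z (first_edge b Z) = None" "s Z (second_edge b Z) = Some d" using near Z by auto
  have oddZ: "odd (card (open_edges s Z))"
    by (rule open_near_odd[OF v Z(1) t Zn far]) (use Z ZA in auto)
  \<comment> \<open>If some path other than \<open>Z\<close> lacked \<open>d\<close> at the near
    end, directing the near edge of \<open>Z\<close> by \<open>d\<close> would still be
    legal.\<close>
  have others: "s Q (first_edge b Q) = Some d" if Q: "Q \<in> Ps - {Z}" for Q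
  proof (rule ccontr)
    assume nQ: "s Q (first_edge b Q) \<noteq> Some d"
    have "can_direct s Z (first_edge b Z) d"
      unfolding can_direct_iff[OF v Z(1) first_edge_less[OF Z(1)] Zn(1)]
    proof (intro conjI allI impI)
      fix j assume "j < len Z" "j = Suc (first_edge b Z) \<or> first_edge b Z = Suc j"
      then have "j = second_edge b Z" by (auto simp: first_edge_def second_edge_def split: if_splits)
      then show "s Z j \<noteq> Some (\<not> d)" using Zn by auto
    next
      fix c assume "first_edge b Z = first_edge c Z"
      then have "c = b" using first_edge_neq[OF Z(1), of b] by (cases "c = b") auto
      then show "\<exists>Q\<in>Ps - {Z}. s Q (first_edge c Q) \<noteq> Some d" using nQ Q by blast
    qed
    then show False using t by blast
  qed
  have evQ: "even (card (open_edges s Q))" if "Q \<in> Ps - {A} - {Z}" for Q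
    using ends_directed_parity[OF v _ t others far, of Q] that by blast
  have oddA: "odd (card (open_edges s A))"
  proof (cases "s A (first_edge (\<not> b) A)")
    case (Some y)
    have "\<exists>P\<in>Ps. s P (first_edge (\<not> b) P) \<noteq> Some d" using v unfolding valid_def by blast
    then have "y \<noteq> d" using far Some by blast
    then show ?thesis using ends_directed_parity[OF v A t dA Some] by auto
  next
    case None
    \<comment> \<open>Direction \<open>\<not> d\<close> is tested because the far edge of
      \<open>Z\<close> carries \<open>d\<close>: the end vertex cannot forbid the move, so the
      neighbouring edge must, and hence it carries \<open>d\<close>.\<close>
    have "\<not> can_direct s A (first_edge (\<not> b) A) (\<not> d)" by (rule t)
    moreover have "\<exists>Q\<in>Ps - {A}. s Q (first_edge c Q) \<noteq> Some (\<not> d)" if "first_edge (\<not> b) A = first_edge c A" for c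
    proof -
      have "c = (\<not> b)" using that first_edge_neq[OF A, of b] by (cases "c = b") auto
      then show ?thesis using far[of Z] Z(1) ZA by (intro bexI[of _ Z]) auto
    qed
    ultimately obtain j where j: "j < len A" "j = Suc (first_edge (\<not> b) A) \<or> first_edge (\<not> b) A = Suc j" "s A j = Some d"
      using can_direct_iff[OF v A first_edge_less[OF A] None, of "\<not> d"] by auto
    moreover have "j = second_edge (\<not> b) A"
      using j by (auto simp: first_edge_def second_edge_def split: if_splits)
    ultimately have "s A (second_edge (\<not> b) A) = Some d" by simp
    then show ?thesis using open_near_odd[OF v A t None, of d] dA by simp
  qed
  have "num_open s = card (open_edges s A) + (card (open_edges s Z) + (\<Sum>Q\<in>Ps - {A} - {Z}. card (open_edges s Q)))"
    unfolding num_open_def using A Z ZA finite_Ps by (simp add: sum.remove)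
  moreover have "even (\<Sum>Q\<in>Ps - {A} - {Z}. card (open_edges s Q))" using evQ by (intro dvd_sum) auto
  ultimately show ?thesis using oddA oddZ by simp
qed


section \<open>Replies that keep a position balanced\<close>

lemma directed_run:
  assumes v: "valid s" and P: "P \<in> Ps" and b: "b < len P"
    and dir: "\<And>k. a \<le> k \<Longrightarrow> k \<le> b \<Longrightarrow> s P k \<noteq> None"
    and i: "a \<le> i" "i \<le> b" "s P i = Some d" and k: "a \<le> k" "k \<le> b"
  shows "s P k = Some d"
proof -
  obtain x where x: "s P a = Some x" using dir[of a] i by auto
  have run: "k \<le> b \<Longrightarrow> s P k = Some x" if "a \<le> k" for k
    using that
  proof (induction k rule: dec_induct)
    case base
    then show ?case using x by simp
  next
    case (step n)
    then have "s P n = Some x" by simp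
    then have "s P (Suc n) \<noteq> Some (\<not> x)" using v P b step.prems unfolding valid_def by fastforce
    then show ?case using dir[of "Suc n"] step by auto
  qed
  then show ?thesis using i k by auto
qed

text \<open>By symmetry both neighbours of the middle edge are in the same state, and a middle edge
  of a path with at least five edges touches neither \<open>u\<close> nor \<open>v\<close>; so
  nothing blocks it.\<close>

lemma free_mid_reply:
  assumes v: "valid s" and C: "C \<in> Ps" and f: "free_mid s C"
  shows "\<exists>x. can_direct s C (mid C) x \<and> paired (direct s C (mid C) x) C"
proof -
  have o: "odd (len C)" "s C (mid C) = None" and sym: "symmetric_path s C"
    using f by (auto simp: free_mid_def mid_open_def)
  have l: "5 \<le> len C" using odd_len_ge_5[OF C o(1)] .
  have m: "mid C < len C" by (rule mid_less[OF C])
  have "mirror C (mid C + 1) = mid C - 1" using o(1) l unfolding mirror_def by presburger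
  moreover have "mid C + 1 < len C" using l by linarith
  ultimately have eq: "s C (mid C + 1) = s C (mid C - 1)"
    using sym unfolding symmetric_path_def by metis
  \<comment> \<open>\<open>True\<close> is an arbitrary choice for the case that both neighbours are
    open.\<close>
  define x where "x = (case s C (mid C - 1) of Some z \<Rightarrow> z | None \<Rightarrow> True)"
  have "can_direct s C (mid C) x"
    unfolding can_direct_iff[OF v C m o(2)]
  proof (intro conjI allI impI)
    fix j assume "j < len C" "j = Suc (mid C) \<or> mid C = Suc j"
    then have "s C j = s C (mid C - 1)" using eq by (elim disjE) auto
    then show "s C j \<noteq> Some (\<not> x)" by (auto simp: x_def split: option.splits)
  next
    fix b assume "mid C = first_edge b C"
    then show "\<exists>Q\<in>Ps - {C}. s Q (first_edge b Q) \<noteq> Some x" using mid_neq_first_edge[OF C o(1)] by blast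
  qed
  moreover have "paired (direct s C (mid C) x) C"
    using sym mirror_mid[OF o(1)] mirror_mirror[of _ C]
    by (auto simp: paired_def symmetric_path_def mid_open_def direct_apply)
       (metis mirror_neq_mid o(1))
  ultimately show ?thesis by blast
qed

lemma status_cong:
  assumes "s' P = s P"
  shows "paired s' P = paired s P" "free_mid s' P = free_mid s P" "hot s' P e d = hot s P e d"
  using assms by (auto simp: paired_def free_mid_def hot_def symmetric_path_def mid_open_def)

lemma paired_not_free: "paired s P \<Longrightarrow> \<not> free_mid s P"
  by (auto simp: paired_def free_mid_def)

text \<open>The mirror image of \<open>e\<close> would be a third open edge besides \<open>e\<close>
  and the middle one.\<close>

lemma hot_not_symmetric: "hot s P e d \<Longrightarrow> \<not> symmetric_path s P"
proof
  assume h: "hot s P e d" and sym: "symmetric_path s P"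
  then have e: "odd (len P)" "e < len P" "e \<noteq> mid P" "s P e = None" by (auto simp: hot_def)
  have "s P (mirror P e) = None" using sym e by (simp add: symmetric_path_def)
  moreover have "mirror P e \<noteq> mid P" using mirror_neq_mid e by blast
  moreover have "mirror P e \<noteq> e" using mirror_fixed e by blast
  ultimately show False using h mirror_less[OF e(2)] by (auto simp: hot_def)
qed

text \<open>Serves a move that is answered on the same path.\<close>

lemma balanced_replace_one:
  assumes bal: "balanced s" and eq: "\<And>Z. Z \<noteq> P \<Longrightarrow> s' Z = s Z"
    and st: "paired s' P \<or> free_mid s' P \<or> (\<exists>e d. hot s' P e d)"
    and fr: "free_mid s' P = free_mid s P"
  shows "balanced s'"
proof -
  have "free_mid s' Z = free_mid s Z" for Z
    using fr eq status_cong(2) by metis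
  moreover have "paired s' Z \<or> free_mid s' Z \<or> (\<exists>e d. hot s' Z e d)" if "Z \<in> Ps" for Z
    using bal that st eq[of Z] status_cong[of s' Z s] unfolding balanced_def by (cases "Z = P") auto
  ultimately show ?thesis using bal unfolding balanced_def by simp
qed

text \<open>Serves a move on \<open>P\<close> answered on \<open>C\<close>: both paths cease to be
  free, so the parity of the number of free paths survives.\<close>

lemma balanced_replace_two:
  assumes bal: "balanced s" and P: "P \<in> Ps" "C \<in> Ps" "P \<noteq> C"
    and eq: "\<And>Z. Z \<noteq> P \<Longrightarrow> Z \<noteq> C \<Longrightarrow> s' Z = s Z"
    and fr: "free_mid s P" "free_mid s C"
    and C: "paired s' C" and st: "paired s' P \<or> (\<exists>e d. hot s' P e d)"
  shows "balanced s'"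
proof -
  have nP: "\<not> free_mid s' P" and nC: "\<not> free_mid s' C"
    using st C paired_not_free hot_not_symmetric by (auto simp: free_mid_def)
  have rest: "free_mid s' Z = free_mid s Z" if "Z \<noteq> P" "Z \<noteq> C" for Z
    using status_cong(2) eq that by metis
  have "{Z \<in> Ps. free_mid s Z} = insert P (insert C {Z \<in> Ps. free_mid s' Z})"
    using nP nC fr P by (auto simp: rest; metis rest)
  moreover have "finite {Z \<in> Ps. free_mid s' Z}" using finite_Ps by simp
  ultimately have "card {Z \<in> Ps. free_mid s Z} = Suc (Suc (card {Z \<in> Ps. free_mid s' Z}))"
    using nP nC P by simp
  then have "even (card {Z \<in> Ps. free_mid s' Z})" using bal unfolding balanced_def by simp
  moreover have "paired s' Z \<or> free_mid s' Z \<or> (\<exists>e d. hot s' Z e d)" if "Z \<in> Ps" for Z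
  proof (cases "Z = P \<or> Z = C")
    case False
    then show ?thesis using bal that eq[of Z] status_cong[of s' Z s] unfolding balanced_def by auto
  qed (use st C in auto)
  ultimately show ?thesis unfolding balanced_def by blast
qed

text \<open>The number of free paths is even and \<open>P\<close> is one of them, so there is
  another one, \<open>C\<close>. Its middle edge is the answer when the move has ended the freedom
  of \<open>P\<close>.\<close>

lemma reply_in_other_path:
  assumes bal: "balanced s" and c: "can_direct s P i d" and f: "free_mid s P"
    and st: "paired (direct s P i d) P \<or> (\<exists>e x. hot (direct s P i d) P e x)"
  shows "\<exists>Q j x. can_direct (direct s P i d) Q j x \<and> balanced (direct (direct s P i d) Q j x)"
proof -
  let ?s = "direct s P i d" and ?F = "{Z \<in> Ps. free_mid s Z}"
  have P: "P \<in> Ps" and v: "valid ?s" using c by (auto simp: can_direct_def)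
  have "?F \<noteq> {P}"
  proof
    assume "?F = {P}"
    then have "card ?F = 1" by simp
    then show False using bal unfolding balanced_def by simp
  qed
  then obtain C where C: "C \<in> Ps" "free_mid s C" "C \<noteq> P" using P f by blast
  then have "free_mid ?s C" using status_cong(2)[of ?s C s] by simp
  then obtain x where x: "can_direct ?s C (mid C) x" "paired (direct ?s C (mid C) x) C"
    using free_mid_reply[OF v C(1)] by blast
  have eqP: "direct ?s C (mid C) x P = ?s P" using C(3) by simp
  have "balanced (direct ?s C (mid C) x)"
    by (rule balanced_replace_two[OF bal P C(1) C(3)[symmetric] _ f C(2) x(2)])
       (use C st status_cong[of "direct ?s C (mid C) x" P ?s] eqP in auto)
  then show ?thesis using x(1) by blast
qed

lemma mirror_pair_symmetric:
  assumes "symmetric_path s P" "i < len P"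
  shows "symmetric_path (direct (direct s P i d) P (mirror P i) d) P"
  unfolding symmetric_path_def
proof (intro allI impI)
  fix k assume k: "k < len P"
  have "mirror P k = i \<longleftrightarrow> k = mirror P i" "mirror P k = mirror P i \<longleftrightarrow> k = i"
    using k assms(2) mirror_mirror by metis+
  then show "direct (direct s P i d) P (mirror P i) d P (mirror P k) =
      direct (direct s P i d) P (mirror P i) d P k"
    using assms(1) k by (auto simp: symmetric_path_def direct_apply)
qed

text \<open>The reply is the other open edge \<open>j\<close>, directed by \<open>x\<close> like the
  rest of the path. Only an end vertex can block it, and then the position is locked with
  \<open>P\<close> in the role of \<open>A\<close>.\<close>

lemma hot_reply:
  assumes v: "valid s" and bal: "balanced s" and h: "hot s P e x" and c: "can_direct s P i d"
  shows "(\<exists>j y. can_direct (direct s P i d) P j y \<and> balanced (direct (direct s P i d) P j y)) \<or>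
    (\<exists>b. locked (direct s P i d) P x b)"
proof -
  let ?s = "direct s P i d"
  have P: "P \<in> Ps" and i: "i < len P" "s P i = None" and vs: "valid ?s"
    using c by (auto simp: can_direct_def)
  have o: "odd (len P)" and e: "e < len P" "e \<noteq> mid P" "s P e = None" and m: "s P (mid P) = None"
    and rest: "\<And>k. k < len P \<Longrightarrow> k \<noteq> mid P \<Longrightarrow> k \<noteq> e \<Longrightarrow> s P k = Some x"
    using h by (auto simp: hot_def)
  have l: "5 \<le> len P" by (rule odd_len_ge_5[OF P o])
  have ml: "mid P < len P" by (rule mid_less[OF P])
  define j where "j = (if i = e then mid P else e)"
  have "i = mid P \<or> i = e" using rest[OF i(1)] i(2) by auto
  then have ij: "i = e \<and> j = mid P \<or> i = mid P \<and> j = e" by (auto simp: j_def)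
  have j: "j < len P" "j \<noteq> i" "s P j = None" using ij e m ml by auto
  \<comment> \<open>An inner edge has two neighbours, at most one of which is \<open>j\<close>. If
    \<open>i\<close> is an end edge, it is \<open>e\<close>, and its neighbour is not the middle
    edge of a path with at least five edges. So \<open>i\<close> has a directed neighbour, which
    fixes its direction.\<close>
  have nbr: "\<exists>k<len P. (k = Suc i \<or> i = Suc k) \<and> k \<noteq> j"
  proof (cases "Suc i < len P \<and> Suc i \<noteq> j")
    case False
    then have "i - 1 < len P \<and> i = Suc (i - 1) \<and> i - 1 \<noteq> j" using ij i l e o by auto
    then show ?thesis by blast
  qed auto
  then obtain k where k: "k < len P" "k = Suc i \<or> i = Suc k" "k \<noteq> j" by blast
  have "s P k = Some x" using rest[OF k(1)] k ij by auto
  moreover have "s P k \<noteq> Some (\<not> d)" using can_direct_iff[OF v P i, of d] c k by blast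
  ultimately have dx: "d = x" by auto
  have all: "?s P k = Some x" if "k < len P" "k \<noteq> j" for k
    using that rest ij dx by (auto simp: direct_apply)
  have jn: "?s P j = None" using j by simp
  show ?thesis
  proof (cases "\<exists>b. j = first_edge b P \<and> \<not> (\<exists>Q\<in>Ps - {P}. ?s Q (first_edge b Q) \<noteq> Some x)")
    case True
    then obtain b where b: "j = first_edge b P" "\<forall>Z\<in>Ps - {P}. s Z (first_edge b Z) = Some x" by auto
    have "first_edge (\<not> b) P \<noteq> j" using first_edge_neq[OF P, of b] b by simp
    then have "locked ?s P x (\<not> b)"
      using b all first_edge_less[OF P] by (intro blocked_locked[OF bal P]) auto
    then show ?thesis by blast
  next
    case False
    then have cj: "can_direct ?s P j x" unfolding can_direct_iff[OF vs P j(1) jn] using all by force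
    have full: "direct ?s P j x P k = Some x" if "k < len P" for k
      using all that by (auto simp: direct_apply)
    have pr: "paired (direct ?s P j x) P"
      unfolding paired_def symmetric_path_def mid_open_def using full ml mirror_less by auto
    have "\<not> free_mid s P" using hot_not_symmetric[OF h] by (auto simp: free_mid_def)
    then have "balanced (direct ?s P j x)"
      using balanced_replace_one[OF bal, of P "direct ?s P j x"] pr paired_not_free[OF pr] by simp
    then show ?thesis using cj by blast
  qed
qed

lemma mirror_or_locked:
  assumes v: "valid s" and bal: "balanced s" and sym: "symmetric_path s P" and c: "can_direct s P i d"
    and ni: "i \<noteq> mid P \<or> even (len P)"
    and keep: "paired (direct (direct s P i d) P (mirror P i) d) P \<and> \<not> free_mid s P \<or>
      free_mid (direct (direct s P i d) P (mirror P i) d) P \<and> free_mid s P"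
  shows "(\<exists>Q j x. can_direct (direct s P i d) Q j x \<and> balanced (direct (direct s P i d) Q j x)) \<or>
    (\<exists>A x b. locked (direct s P i d) A x b)"
  using mirror_reply[OF v sym c ni]
proof
  assume r: "can_direct (direct s P i d) P (mirror P i) d"
  have "balanced (direct (direct s P i d) P (mirror P i) d)"
    by (rule balanced_replace_one[OF bal, of P]) (use keep paired_not_free in auto)
  then show ?thesis using r by blast
next
  assume "\<exists>b. i = first_edge b P \<and> (\<forall>Z\<in>Ps - {P}. s Z (first_edge (\<not> b) Z) = Some d)"
  then obtain b where b: "i = first_edge b P" "\<forall>Z\<in>Ps - {P}. s Z (first_edge (\<not> b) Z) = Some d" by blast
  have "P \<in> Ps" using c by (auto simp: can_direct_def)
  then have "locked (direct s P i d) P d b"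
    using b by (intro blocked_locked[OF bal]) auto
  then show ?thesis by blast
qed

text \<open>After the move all edges on the side of the middle edge containing \<open>i\<close> are
  directed, so validity spreads \<open>d\<close> over that side. Symmetry carries it to the other
  side, except to the mirror image of \<open>i\<close>.\<close>

lemma becomes_hot:
  assumes f: "free_mid s P" and c: "can_direct s P i d" and i: "i \<noteq> mid P"
    and rest: "\<And>k. k < len P \<Longrightarrow> k \<noteq> mid P \<Longrightarrow> k \<noteq> i \<Longrightarrow> k \<noteq> mirror P i \<Longrightarrow> s P k \<noteq> None"
  shows "hot (direct s P i d) P (mirror P i) d"
proof -
  let ?s = "direct s P i d"
  have P: "P \<in> Ps" and il: "i < len P" "s P i = None" and vs: "valid ?s"
    using c by (auto simp: can_direct_def)
  have o: "odd (len P)" and m: "s P (mid P) = None" and sym: "symmetric_path s P"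
    using f by (auto simp: free_mid_def mid_open_def)
  have ni: "i \<noteq> mid P \<or> even (len P)" using i by simp
  note mi = paired_mirror[OF sym c ni]
  have side: "k < mid P \<longleftrightarrow> mid P < mirror P k" if "k < len P" for k
    using that o by (auto simp: mirror_def elim!: oddE)
  have near: "?s P k = Some d" if k: "k < len P" "k \<noteq> mid P" "k < mid P \<longleftrightarrow> i < mid P" for k
  proof -
    have dir: "?s P k \<noteq> None" if "k < len P" "k \<noteq> mid P" "k < mid P \<longleftrightarrow> i < mid P" for k
      using rest[of k] that side[OF il(1)] mirror_neq_mid[OF il(1) o i] i by (auto simp: direct_apply)
    \<comment> \<open>First and last index of the side of the middle edge that contains
      \<open>i\<close>.\<close>
    define a b where "a = (if i < mid P then 0 else Suc (mid P))"
      and "b = (if i < mid P then mid P - 1 else len P - 1)"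
    have "b < len P" using il mid_less[OF P] by (auto simp: b_def)
    moreover have "?s P k \<noteq> None" if "a \<le> k" "k \<le> b" for k
      using that il mid_less[OF P] by (intro dir) (auto simp: a_def b_def split: if_splits)
    moreover have "a \<le> i" "i \<le> b" "a \<le> k" "k \<le> b" using k i il by (auto simp: a_def b_def)
    ultimately show ?thesis using directed_run[OF vs P, of b a i d k] by simp
  qed
  have "?s P k = Some d" if k: "k < len P" "k \<noteq> mid P" "k \<noteq> mirror P i" for k
  proof (cases "k < mid P \<longleftrightarrow> i < mid P")
    case True
    then show ?thesis using near k by blast
  next
    case False
    have "mirror P k \<noteq> i" using k mirror_mirror by metis
    moreover have "k \<noteq> i" using False by auto
    ultimately have "?s P k = ?s P (mirror P k)" using sym k(1) by (simp add: symmetric_path_def direct_apply)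
    also have "\<dots> = Some d"
      using near[of "mirror P k"] mirror_less[OF k(1)] mirror_neq_mid[OF k(1) o k(2)] side[OF k(1)] False k(2) by auto
    finally show ?thesis .
  qed
  then show ?thesis
    unfolding hot_def using o mi mirror_neq_mid[OF il(1) o i] m i by (auto simp: direct_apply)
qed

text \<open>A move on a paired path is answered by the mirror image. So is a move on a free path,
  unless it took the middle edge or made the path hot; these two cases end the freedom of
  \<open>P\<close> and are answered on another free path. A hot path is answered by its other open
  edge.\<close>

lemma balanced_reply:
  assumes v: "valid s" and bal: "balanced s" and c: "can_direct s P i d"
  shows "(\<exists>Q j x. can_direct (direct s P i d) Q j x \<and> balanced (direct (direct s P i d) Q j x)) \<or>
    (\<exists>A x b. locked (direct s P i d) A x b)"
proof -
  let ?s = "direct s P i d" and ?r = "direct (direct s P i d) P (mirror P i) d"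
  have P: "P \<in> Ps" and i: "i < len P" "s P i = None" using c by (auto simp: can_direct_def)
  consider (paired) "paired s P" | (free) "free_mid s P" | (hot) e x where "hot s P e x"
    using bal P unfolding balanced_def by blast
  then show ?thesis
  proof cases
    case paired
    then have sym: "symmetric_path s P" and nm: "\<not> mid_open s P" by (auto simp: paired_def)
    have ni: "i \<noteq> mid P \<or> even (len P)" using nm i by (auto simp: mid_open_def)
    have "paired ?r P"
      using mirror_pair_symmetric[OF sym i(1)] nm by (auto simp: paired_def mid_open_def direct_apply)
    then show ?thesis
      using mirror_or_locked[OF v bal sym c ni] paired_not_free[OF paired] by blast
  next
    case free
    then have sym: "symmetric_path s P" and o: "odd (len P)" and m: "s P (mid P) = None"
      by (auto simp: free_mid_def mid_open_def)
    show ?thesis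
    proof (cases "i = mid P")
      case True
      have "paired ?s P"
        using mirror_pair_symmetric[OF sym i(1), of d] True mirror_mid[OF o]
        by (auto simp: paired_def mid_open_def direct_def)
      then show ?thesis using reply_in_other_path[OF bal c free] by blast
    next
      case False
      show ?thesis
      proof (cases "\<exists>k<len P. k \<noteq> mid P \<and> k \<noteq> i \<and> k \<noteq> mirror P i \<and> s P k = None")
        case True
        then obtain k where k: "k < len P" "k \<noteq> mid P" "k \<noteq> i" "k \<noteq> mirror P i" "s P k = None" by blast
        have "free_mid ?r P"
          unfolding free_mid_def mid_open_def
        proof (intro conjI exI[of _ k])
          show "?r P (mid P) = None" using m False mirror_neq_mid[OF i(1) o False] by (simp add: direct_apply)
          show "?r P k = None" using k by (simp add: direct_apply)
        qed (use mirror_pair_symmetric[OF sym i(1)] o k in auto)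
        then show ?thesis using mirror_or_locked[OF v bal sym c] False free by blast
      next
        case none: False
        have "hot ?s P (mirror P i) d"
          by (rule becomes_hot[OF free c False]) (use none in metis)
        then show ?thesis using reply_in_other_path[OF bal c free] by blast
      qed
    qed
  next
    case hot
    then show ?thesis using hot_reply[OF v bal _ c] by blast
  qed
qed

text \<open>In a locked position every legal move serves as a reply. One exists, because an odd
  number of edges is open after the opponent's move, while \<open>locked_terminal\<close> gives an
  even number when no move is left.\<close>

theorem good_reply:
  assumes g: "good s" and c: "can_direct s P i d"
  shows "\<exists>Q j x. can_direct (direct s P i d) Q j x \<and> good (direct (direct s P i d) Q j x)"
proof -
  let ?s = "direct s P i d"
  have v: "valid s" and ev: "even (num_open s)" and vs: "valid ?s"
    using g c by (auto simp: good_def can_direct_def)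
  have od: "odd (num_open ?s)" using num_open_direct[OF c] ev by simp
  have goodI: "good (direct ?s Q j x)"
    if "can_direct ?s Q j x" "balanced (direct ?s Q j x) \<or> (\<exists>A y b. locked (direct ?s Q j x) A y b)" for Q j x
    using that num_open_direct[OF that(1)] od unfolding good_def can_direct_def by simp
  have lock: ?thesis if l: "locked ?s A y b" for A y b
  proof -
    obtain Q j x where q: "can_direct ?s Q j x" using locked_terminal[OF vs l] od by blast
    then show ?thesis using goodI locked_direct[OF vs l q] by blast
  qed
  show ?thesis
  proof (cases "balanced s")
    case True
    then show ?thesis using balanced_reply[OF v True c] lock goodI by blast
  next
    case False
    then obtain A y b where "locked s A y b" using g by (auto simp: good_def)
    then show ?thesis using lock locked_direct[OF v _ c] by blast
  qed
qed

text \<open>Under \<^const>\<open>balanced\<close> the reason is that no path has exactly one open edge.\<close>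

theorem good_no_completion:
  assumes g: "good s" and c: "can_direct s P i d" and full: "all_directed (direct s P i d) P e"
    and Q: "Q \<in> Ps" "all_directed (direct s P i d) Q True"
    and R: "R \<in> Ps" "all_directed (direct s P i d) R False"
  shows False
proof -
  let ?s = "direct s P i d"
  have v: "valid s" and P: "P \<in> Ps" and i: "i < len P" "s P i = None"
    using g c by (auto simp: good_def can_direct_def)
  have only: "k = i" if "k < len P" "s P k = None" for k
    using full that by (auto simp: all_directed_def direct_apply split: if_splits)
  show False
  proof (cases "balanced s")
    case True
    then consider "paired s P" | "free_mid s P" | e x where "hot s P e x"
      using P unfolding balanced_def by blast
    then show False
    proof cases
      case 1
      then have "s P (mirror P i) = None" using i by (simp add: paired_def symmetric_path_def)
      then have "mirror P i = i" using only mirror_less i by blast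
      then show False using 1 mirror_fixed[OF i(1)] i(2) by (auto simp: paired_def mid_open_def)
    next
      case 2
      then show False using only mid_less[OF P] by (auto simp: free_mid_def mid_open_def)
    next
      case 3
      then show False using only[of "mid P"] only[of e] mid_less[OF P] by (auto simp: hot_def)
    qed
  next
    case False
    then obtain A y b where "locked s A y b" using g by (auto simp: good_def)
    then have "locked ?s A y b" using locked_direct[OF v _ c] by blast
    \<comment> \<open>\<open>Q\<close> and \<open>R\<close> run in opposite directions, so one of
      them runs against \<open>y\<close>, which \<open>locked\<close> excludes.\<close>
    then show False using locked_not_all_directed Q R by (cases y) fastforce+
  qed
qed

section \<open>The empty position and the opening move\<close>

lemma even_sum_card_odd: "finite A \<Longrightarrow> even (sum f A) \<longleftrightarrow> even (card {x \<in> A. odd (f x :: nat)})"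
proof (induction A rule: finite_induct)
  case (insert x F)
  have "{y \<in> insert x F. odd (f y)} = (if odd (f x) then insert x {y \<in> F. odd (f y)} else {y \<in> F. odd (f y)})"
    by auto
  then show ?case using insert by auto
qed simp

abbreviation blank :: "'p \<Rightarrow> nat \<Rightarrow> bool option" where
  "blank \<equiv> \<lambda>_ _. None"

lemma free_mid_blank: "P \<in> Ps \<Longrightarrow> free_mid blank P \<longleftrightarrow> odd (len P)"
  using odd_len_ge_5[of P]
  by (auto simp: free_mid_def symmetric_path_def mid_open_def intro!: exI[of _ 0])

lemma paired_blank: "paired blank P \<longleftrightarrow> even (len P)"
  by (auto simp: paired_def symmetric_path_def mid_open_def)

lemma valid_blank: "Ps \<noteq> {} \<Longrightarrow> valid blank"
  by (auto simp: valid_def)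

lemma num_open_blank: "num_open blank = sum len Ps"
  by (simp add: num_open_def open_edges_def)

lemma good_blank:
  assumes "Ps \<noteq> {}" "even (sum len Ps)"
  shows "good blank"
proof -
  have "{P \<in> Ps. free_mid blank P} = {P \<in> Ps. odd (len P)}" using free_mid_blank by blast
  then have "balanced blank"
    using assms free_mid_blank paired_blank even_sum_card_odd[OF finite_Ps, of len] by (auto simp: balanced_def)
  then show ?thesis using assms valid_blank num_open_blank by (simp add: good_def)
qed

text \<open>An odd total forces an odd number of odd paths, all of them free at the start; directing
  one of their middle edges makes the number of free paths even.\<close>

lemma good_first_move:
  assumes "odd (sum len Ps)"
  shows "\<exists>P i d. can_direct blank P i d \<and> good (direct blank P i d)"
proof -
  let ?F = "\<lambda>s. {P \<in> Ps. free_mid s P}"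
  have ne: "Ps \<noteq> {}" using assms by auto
  have F: "?F blank = {P \<in> Ps. odd (len P)}" using free_mid_blank by blast
  have od: "odd (card (?F blank))"
    unfolding F using assms even_sum_card_odd[OF finite_Ps, of len] by simp
  then have "?F blank \<noteq> {}" by (metis card.empty even_zero)
  then obtain C where C: "C \<in> Ps" "free_mid blank C" by blast
  obtain x where x: "can_direct blank C (mid C) x" "paired (direct blank C (mid C) x) C"
    using free_mid_reply[OF valid_blank[OF ne] C] by blast
  let ?s = "direct blank C (mid C) x"
  have "?F blank = insert C (?F ?s)"
    using C paired_not_free[OF x(2)] status_cong(2)[of ?s _ blank] by (auto; metis direct_simps(2))
  moreover have "C \<notin> ?F ?s" "finite (?F ?s)" using paired_not_free[OF x(2)] finite_Ps by auto
  ultimately have "even (card (?F ?s))" using od by simp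
  moreover have "paired ?s Z \<or> free_mid ?s Z" if "Z \<in> Ps" for Z
    using that x(2) free_mid_blank[OF that] paired_blank[of Z] status_cong[of ?s Z blank]
    by (cases "Z = C") auto
  ultimately have "balanced ?s" by (auto simp: balanced_def)
  moreover have "even (num_open ?s)" using num_open_direct[OF x(1)] assms num_open_blank by simp
  ultimately show ?thesis using x(1) unfolding good_def can_direct_def by blast
qed

end

section \<open>Plays of the game on a union of disjoint paths\<close>

text \<open>\<open>Inv\<close> is meant for positions with the opponent of \<open>X\<close> to move,
  \<open>Ready\<close> for those with \<open>X\<close> to move. A \<open>Ready\<close> position is
  never final, so the game can only end with the opponent to move, and then \<open>winner\<close> is
  \<open>X\<close>.\<close>

lemma has_winning_strategy_from_invariant:
  fixes G :: "'v pair_pre_digraph" and C :: "('v \<times> 'v) list set"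
    and Inv :: "('v \<times> 'v) set \<Rightarrow> bool"
  defines "Ready D \<equiv> \<not> cell_completed C D \<and> (\<exists>b. legal_move G D b \<and> Inv (insert b D))"
  assumes start: "if X = Player1 then Ready {} else Inv {}"
    and step: "\<And>D a. Inv D \<Longrightarrow> \<not> game_over G C D \<Longrightarrow> legal_move G D a \<Longrightarrow> Ready (insert a D)"
  shows "has_winning_strategy G C X"
proof -
  define s where "s h = (SOME b. legal_move G (set h) b \<and> Inv (insert b (set h)))" for h
  have s: "legal_move G (set h) (s h) \<and> Inv (insert (s h) (set h))" if "Ready (set h)" for h
    using that unfolding s_def Ready_def by (metis (mono_tags, lifting) someI_ex)
  have turn_snoc: "to_move (h @ [a]) = X \<longleftrightarrow> to_move h \<noteq> X" for h a
    by (cases X) (auto simp: to_move_def)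
  have main: "if to_move h = X then Ready (set h) else Inv (set h)"
    if "play G C h" "follows_strategy X s h" for h
    using that
  proof (induction h rule: play.induct)
    case play_Nil
    then show ?case using start by (cases X) (auto simp: to_move_def)
  next
    case (play_snoc h a)
    have f: "follows_strategy X s h"
      unfolding follows_strategy_def
    proof (intro allI impI)
      fix i assume "i < length h" "to_move (take i h) = X"
      then show "h ! i = s (take i h)"
        using play_snoc.prems[unfolded follows_strategy_def, rule_format, of i] by (simp add: nth_append)
    qed
    show ?case
    proof (cases "to_move h = X")
      case True
      then have "a = s h"
        using play_snoc.prems[unfolded follows_strategy_def, rule_format, of "length h"] by simp
      then show ?thesis using play_snoc.IH[OF f] True s[of h] by (simp add: turn_snoc)
    next
      case False
      then show ?thesis
        using play_snoc.IH[OF f] step[OF _ play_snoc.hyps(2,3)] by (simp add: turn_snoc)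
    qed
  qed
  have "winning_strategy G C X s"
    unfolding winning_strategy_def
  proof (intro allI impI, elim conjE)
    fix h assume h: "play G C h" "follows_strategy X s h"
    show "if game_over G C (set h) then winner h = X else to_move h = X \<longrightarrow> legal_move G (set h) (s h)"
    proof (cases "to_move h = X")
      case True
      then have r: "Ready (set h)" using main[OF h] by simp
      then have "\<not> game_over G C (set h)" unfolding Ready_def game_over_def by blast
      then show ?thesis using s[OF r] by simp
    next
      case False
      then have "winner h = X" by (cases X) (auto simp: to_move_def winner_def split: if_splits)
      then show ?thesis using False by simp
    qed
  qed
  then show ?thesis unfolding has_winning_strategy_def by blast
qed

section \<open>Arcs of walks and of closed walks\<close>

lemma pawalk_verts_path:
  assumes "pcas x P y"
  shows "length (pawalk_verts x P) = Suc (length P)" "pawalk_verts x P ! 0 = x"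
    "pawalk_verts x P ! length P = y"
    "i < length P \<Longrightarrow> P ! i = (pawalk_verts x P ! i, pawalk_verts x P ! Suc i)"
  using assms
proof (induction P arbitrary: x i)
  case (Cons e P)
  {
    case 1 then show ?case using Cons by auto
  next
    case 2 then show ?case using Cons by auto
  next
    case 3 then show ?case using Cons by auto
  next
    case 4
    then have "pcas (snd e) P y" "fst e = x" by auto
    then show ?case using Cons 4(1) by (cases i) (auto simp: prod_eq_iff)
  }
qed auto

lemma uedge_eq_iff: "uedge a = uedge b \<longleftrightarrow> a = b \<or> a = prod.swap b"
  by (cases a; cases b) (auto simp: uedge_def doubleton_eq_iff)

text \<open>The witnesses are the cyclic successor and predecessor of \<open>a\<close>. As heads are
  distinct, turning back along \<open>a\<close> would close the walk after two steps, contrary to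
  its length.\<close>

lemma closed_walk_neighbours:
  assumes c: "pcas w c w" and d: "distinct (map snd c)" and l: "3 \<le> length c" and a: "a \<in> set c"
  shows "\<exists>b\<in>set c. fst b = snd a \<and> snd b \<noteq> fst a"
    and "\<exists>b\<in>set c. snd b = fst a \<and> fst b \<noteq> snd a"
proof -
  define n where "n = length c"
  define vs where "vs = pawalk_verts w c"
  note nth = pawalk_verts_path[OF c, folded vs_def n_def]
  have n: "3 \<le> n" using l n_def by simp
  have suc: "fst (c ! (Suc k mod n)) = snd (c ! k)" if "k < n" for k
  proof (cases "Suc k = n")
    case True
    then have "snd (c ! k) = w" using nth(3) nth(4)[of k] that by simp
    moreover have "fst (c ! 0) = w" using nth(2) nth(4)[of 0] n by simp
    ultimately show ?thesis using True by simp
  next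
    case False
    then show ?thesis using nth(4)[of k] nth(4)[of "Suc k"] that by simp
  qed
  have inj: "i = j" if "i < n" "j < n" "snd (c ! i) = snd (c ! j)" for i j
    using d that nth_eq_iff_index_eq[of "map snd c" i j] by (simp add: n_def)
  have two: "Suc (Suc k mod n) mod n \<noteq> k" if "k < n" for k
    using that n by (cases "Suc k = n"; cases "Suc (Suc k) = n") auto
  have pred: "\<exists>j<n. Suc j mod n = k" if "k < n" for k
    using that n by (cases k) (auto intro: exI[of _ "n - 1"] exI[of _ "k - 1"])
  obtain k where k: "k < n" "a = c ! k" using a unfolding n_def by (metis in_set_conv_nth)
  have sk: "Suc k mod n < n" using n by simp
  obtain j where j: "j < n" "Suc j mod n = k" using pred k by blast
  obtain i where i: "i < n" "Suc i mod n = j" using pred j by blast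
  have "snd (c ! (Suc k mod n)) \<noteq> fst a"
  proof
    assume "snd (c ! (Suc k mod n)) = fst a"
    then have "snd (c ! (Suc k mod n)) = snd (c ! j)" using suc[OF j(1)] j k by simp
    then have "Suc k mod n = j" using inj sk j by blast
    then show False using two[OF k(1)] j by simp
  qed
  then show "\<exists>b\<in>set c. fst b = snd a \<and> snd b \<noteq> fst a"
    using suc[OF k(1)] sk k by (intro bexI[of _ "c ! (Suc k mod n)"]) (auto simp: n_def)
  have "fst (c ! j) \<noteq> snd a"
  proof
    assume "fst (c ! j) = snd a"
    then have "snd (c ! i) = snd (c ! k)" using suc[OF i(1)] i k by simp
    then have "i = k" using inj i k by blast
    then show False using two[OF i(1)] i j by simp
  qed
  then show "\<exists>b\<in>set c. snd b = fst a \<and> fst b \<noteq> snd a"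
    using suc[OF j(1)] j k by (intro bexI[of _ "c ! j"]) (auto simp: n_def)
qed

section \<open>The graph as a bundle of paths\<close>

locale disjoint_paths = pair_graph G for G :: "'v pair_pre_digraph" +
  fixes u v :: 'v and Ps :: "('v \<times> 'v) list set"
  assumes union: "union_of_disjoint_paths G u v Ps"
    and odd_length: "\<And>P. P \<in> Ps \<Longrightarrow> odd (length P) \<Longrightarrow> 5 \<le> length P"
begin

definition vert :: "('v \<times> 'v) list \<Rightarrow> nat \<Rightarrow> 'v" where
  "vert P i = pawalk_verts u P ! i"

definition arc_at :: "('v \<times> 'v) list \<Rightarrow> nat \<Rightarrow> bool \<Rightarrow> 'v \<times> 'v" where
  "arc_at P i d = (if d then P ! i else prod.swap (P ! i))"

text \<open>The value \<open>None\<close> off the bundle allows equations between functions: the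
  empty position becomes \<open>blank\<close>, and a move acts as \<open>direct\<close>.\<close>

definition state :: "('v \<times> 'v) set \<Rightarrow> ('v \<times> 'v) list \<Rightarrow> nat \<Rightarrow> bool option" where
  "state D P i = (if P \<in> Ps \<and> i < length P
     then if P ! i \<in> D then Some True else if prod.swap (P ! i) \<in> D then Some False else None
     else None)"

definition oriented :: "('v \<times> 'v) set \<Rightarrow> bool" where
  "oriented D \<longleftrightarrow> (\<forall>a\<in>D. prod.swap a \<notin> D)"

lemma path:
  assumes "P \<in> Ps"
  shows "pcas u P v" "set P \<subseteq> parcs G" "distinct (pawalk_verts u P)"
  using union assms
  by (auto simp: union_of_disjoint_paths_def apath_def awalk_def)

lemma u_neq_v: "u \<noteq> v" and Ps_nonempty: "Ps \<noteq> {}" and finite_paths: "finite Ps"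
  using union by (auto simp: union_of_disjoint_paths_def)

text \<open>A path of length 1 would be an odd path with fewer than five edges.\<close>

lemma length_ge_2: "P \<in> Ps \<Longrightarrow> 2 \<le> length P"
proof -
  assume P: "P \<in> Ps"
  then have "P \<noteq> []" using path(1)[OF P] u_neq_v by auto
  then show ?thesis using odd_length[OF P] by (cases P rule: list.exhaust; cases "tl P") auto
qed

sublocale path_bundle Ps length
  using finite_paths length_ge_2 odd_length by unfold_locales auto

lemma vert_simps:
  assumes "P \<in> Ps"
  shows "vert P 0 = u" "vert P (length P) = v" "i < length P \<Longrightarrow> P ! i = (vert P i, vert P (Suc i))"
  using pawalk_verts_path[OF path(1)[OF assms]] by (auto simp: vert_def)

lemma set_verts: "P \<in> Ps \<Longrightarrow> set (pawalk_verts u P) = vert P ` {..length P}"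
  using pawalk_verts_path(1)[OF path(1)] by (fastforce simp: vert_def set_conv_nth)

lemma vert_eq_same:
  assumes P: "P \<in> Ps" and "i \<le> length P" "j \<le> length P"
  shows "vert P i = vert P j \<longleftrightarrow> i = j"
  using nth_eq_iff_index_eq[OF path(3)[OF P]] pawalk_verts_path(1)[OF path(1)[OF P]] assms
  by (simp add: vert_def)

lemma vert_eq_iff:
  assumes P: "P \<in> Ps" and Q: "Q \<in> Ps" and i: "i \<le> length P" and j: "j \<le> length Q"
  shows "vert P i = vert Q j \<longleftrightarrow>
    P = Q \<and> i = j \<or> i = 0 \<and> j = 0 \<or> i = length P \<and> j = length Q"
proof (cases "P = Q")
  case True
  then show ?thesis using vert_eq_same[OF P i, of j] j by auto
next
  case False
  have ends: "vert R k \<in> {u, v} \<Longrightarrow> k = 0 \<and> vert R k = u \<or> k = length R \<and> vert R k = v"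
    if "R \<in> Ps" "k \<le> length R" for R k
    using vert_eq_same[OF that(1), of k 0] vert_eq_same[OF that(1), of k "length R"] vert_simps[OF that(1)] that
    by auto
  have "set (pawalk_verts u P) \<inter> set (pawalk_verts u Q) = {u, v}"
    using union P Q False by (simp add: union_of_disjoint_paths_def)
  moreover have "vert P i \<in> set (pawalk_verts u P)" "vert Q j \<in> set (pawalk_verts u Q)"
    using set_verts P Q i j by auto
  ultimately have "vert P i = vert Q j \<Longrightarrow> vert P i \<in> {u, v}" by auto
  then show ?thesis using ends[OF P i] ends[OF Q j] vert_simps[OF P] vert_simps[OF Q] u_neq_v False by auto
qed

lemma arc_at_eq:
  assumes "P \<in> Ps" "i < length P"
  shows "arc_at P i d = (vert P (if d then i else Suc i), vert P (if d then Suc i else i))"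
  using vert_simps(3)[OF assms] by (simp add: arc_at_def)

lemma swap_arc_at: "prod.swap (arc_at P i d) = arc_at P i (\<not> d)"
  by (simp add: arc_at_def)

text \<open>Distinct paths share only \<open>u\<close> and \<open>v\<close>, and no arc of a path
  joins these two, since every path has at least two edges.\<close>

lemma arc_at_inj:
  assumes P: "P \<in> Ps" "i < length P" and Q: "Q \<in> Ps" "j < length Q"
    and eq: "arc_at P i d = arc_at Q j e"
  shows "P = Q" "i = j" "d = e"
proof -
  have 1: "vert P (if d then i else Suc i) = vert Q (if e then j else Suc j)"
    and 2: "vert P (if d then Suc i else i) = vert Q (if e then Suc j else j)"
    using eq by (auto simp: arc_at_eq[OF P] arc_at_eq[OF Q])
  have len: "2 \<le> length P" "2 \<le> length Q" using length_ge_2 P Q by auto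
  have "P = Q \<and> i = j \<and> d = e"
    using 1 2 P(2) Q(2) len
      vert_eq_iff[OF P(1) Q(1), of "if d then i else Suc i" "if e then j else Suc j"]
      vert_eq_iff[OF P(1) Q(1), of "if d then Suc i else i" "if e then Suc j else j"]
    by (cases d; cases e) auto
  then show "P = Q" "i = j" "d = e" by auto
qed

lemma arc_at_in_arcs: "P \<in> Ps \<Longrightarrow> i < length P \<Longrightarrow> arc_at P i d \<in> parcs G"
proof -
  assume P: "P \<in> Ps" "i < length P"
  then have "P ! i \<in> parcs G" using path(2) nth_mem by blast
  then show ?thesis using arcs_symmetric by (cases "P ! i") (auto simp: arc_at_def)
qed

lemma uedges_eq: "uedges G = (\<Union>P\<in>Ps. uedge ` set P)"
  using union unfolding union_of_disjoint_paths_def by blast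

lemma arcs_cases:
  assumes "a \<in> parcs G"
  obtains P i d where "P \<in> Ps" "i < length P" "a = arc_at P i d"
proof -
  have "uedge a \<in> uedges G" using assms by (auto simp: uedges_def)
  then obtain P b where P: "P \<in> Ps" "b \<in> set P" "uedge a = uedge b" unfolding uedges_eq by blast
  then obtain i where i: "i < length P" "b = P ! i" by (metis in_set_conv_nth)
  have "a = arc_at P i True \<or> a = arc_at P i False"
    using P(3) i by (auto simp: uedge_eq_iff arc_at_def)
  then show ?thesis using that P i by blast
qed

lemma card_uedges: "card (uedges G) = (\<Sum>P\<in>Ps. length P)"
proof -
  have "inj_on (\<lambda>(P, i). uedge (P ! i)) (Sigma Ps (\<lambda>P. {..<length P}))"
  proof (rule inj_onI, clarsimp)
    fix P i Q j
    assume a: "P \<in> Ps" "i < length P" "Q \<in> Ps" "j < length Q" "uedge (P ! i) = uedge (Q ! j)"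
    then have "arc_at P i True = arc_at Q j True \<or> arc_at P i True = arc_at Q j False"
      by (auto simp: uedge_eq_iff arc_at_def)
    then show "P = Q \<and> i = j" using arc_at_inj[OF a(1-4)] by blast
  qed
  moreover have "(\<lambda>(P, i). uedge (P ! i)) ` (Sigma Ps (\<lambda>P. {..<length P})) = uedges G"
    unfolding uedges_eq by (force simp: set_conv_nth image_iff)
  ultimately have "card (uedges G) = card (Sigma Ps (\<lambda>P. {..<length P}))" using card_image by metis
  then show ?thesis using finite_paths by simp
qed

section \<open>Positions of the game as positions of the bundle\<close>

lemma state_eq_Some:
  assumes "oriented D" "P \<in> Ps" "i < length P"
  shows "state D P i = Some d \<longleftrightarrow> arc_at P i d \<in> D"
  using assms by (cases d) (auto simp: state_def arc_at_def oriented_def)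

lemma state_eq_None:
  assumes "P \<in> Ps" "i < length P"
  shows "state D P i = None \<longleftrightarrow> arc_at P i d \<notin> D \<and> prod.swap (arc_at P i d) \<notin> D"
  using assms by (cases d) (auto simp: state_def arc_at_def)

lemma state_insert:
  assumes P: "P \<in> Ps" "i < length P" and n: "state D P i = None"
  shows "state (insert (arc_at P i d) D) = direct (state D) P i d"
proof (intro ext)
  fix Q j
  show "state (insert (arc_at P i d) D) Q j = direct (state D) P i d Q j"
  proof (cases "Q \<in> Ps \<and> j < length Q")
    case True
    then have Q: "Q \<in> Ps" "j < length Q" by auto
    have "arc_at Q j e = arc_at P i d \<longleftrightarrow> Q = P \<and> j = i \<and> e = d" for e
      using arc_at_inj[OF Q P, of e d] by auto
    from this[of True] this[of False]
    have eq: "Q ! j = arc_at P i d \<longleftrightarrow> Q = P \<and> j = i \<and> d" "prod.swap (Q ! j) = arc_at P i d \<longleftrightarrow> Q = P \<and> j = i \<and> \<not> d"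
      unfolding arc_at_def[of Q] by simp_all
    show ?thesis
    proof (cases "Q = P \<and> j = i")
      case True
      then have "P ! i \<notin> D" using n P by (auto simp: state_def split: if_splits)
      then show ?thesis using True P eq by (cases d) (simp_all add: state_def)
    next
      case False
      then have "Q ! j \<noteq> arc_at P i d" "prod.swap (Q ! j) \<noteq> arc_at P i d" using eq by blast+
      then have "state (insert (arc_at P i d) D) Q j = state D Q j" by (simp add: state_def)
      moreover have "direct (state D) P i d Q j = state D Q j" using False by (auto simp: direct_apply)
      ultimately show ?thesis by simp
    qed
  next
    case False
    then show ?thesis using P by (auto simp: state_def direct_apply)
  qed
qed

lemma out_arcs_u: "(u, x) \<in> parcs G \<longleftrightarrow> (\<exists>P\<in>Ps. (u, x) = arc_at P 0 True)"
  and out_arcs_v: "(v, x) \<in> parcs G \<longleftrightarrow> (\<exists>P\<in>Ps. (v, x) = arc_at P (length P - 1) False)"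
proof -
  have *: "(y, x) = arc_at P i d \<Longrightarrow> P \<in> Ps \<Longrightarrow> i < length P \<Longrightarrow> (y = u \<longrightarrow> i = 0 \<and> d) \<and> (y = v \<longrightarrow> i = length P - 1 \<and> \<not> d)" for y P i d
  proof -
    assume P: "P \<in> Ps" "i < length P" and e: "(y, x) = arc_at P i d"
    then have "y = vert P (if d then i else Suc i)" by (simp add: arc_at_eq)
    moreover have "vert P k = u \<longleftrightarrow> k = 0" "vert P k = v \<longleftrightarrow> k = length P" if "k \<le> length P" for k
      using vert_eq_same[OF P(1) that, of 0] vert_eq_same[OF P(1) that, of "length P"] vert_simps[OF P(1)] by auto
    ultimately show ?thesis using P(2) by (auto split: if_splits)
  qed
  have l: "P \<in> Ps \<Longrightarrow> 0 < length P" for P using length_ge_2[of P] by auto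
  show "(u, x) \<in> parcs G \<longleftrightarrow> (\<exists>P\<in>Ps. (u, x) = arc_at P 0 True)"
    by (metis (full_types) * arcs_cases arc_at_in_arcs l)
  show "(v, x) \<in> parcs G \<longleftrightarrow> (\<exists>P\<in>Ps. (v, x) = arc_at P (length P - 1) False)"
    by (metis (full_types) * arcs_cases arc_at_in_arcs l diff_less zero_less_one)
qed

lemma out_arcs_inner:
  assumes P: "P \<in> Ps" and i: "Suc i < length P"
  shows "(vert P (Suc i), x) \<in> parcs G \<longleftrightarrow>
    (vert P (Suc i), x) = arc_at P i False \<or> (vert P (Suc i), x) = arc_at P (Suc i) True"
proof
  assume "(vert P (Suc i), x) \<in> parcs G"
  then obtain Q j d where Q: "Q \<in> Ps" "j < length Q" "(vert P (Suc i), x) = arc_at Q j d"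
    by (rule arcs_cases)
  then have "vert P (Suc i) = vert Q (if d then j else Suc j)" by (simp add: arc_at_eq)
  then have "P = Q \<and> Suc i = (if d then j else Suc j)"
    using vert_eq_iff[OF P Q(1), of "Suc i" "if d then j else Suc j"] i Q(2) by auto
  then show "(vert P (Suc i), x) = arc_at P i False \<or> (vert P (Suc i), x) = arc_at P (Suc i) True"
    using Q by (cases d) auto
qed (use arc_at_in_arcs P i Suc_lessD in metis)

lemma arcs_swap: "(x, y) \<in> parcs G \<longleftrightarrow> (y, x) \<in> parcs G"
  using arcs_symmetric by blast

lemma is_sink_iff_source: "is_sink G D w \<longleftrightarrow> is_source G (prod.swap ` D) w"
  unfolding is_sink_def is_source_def using arcs_swap by (force simp: image_iff)

lemma oriented_swap: "oriented (prod.swap ` D) \<longleftrightarrow> oriented D"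
  by (force simp: oriented_def)

lemma arc_at_swap: "arc_at P i d \<in> prod.swap ` D \<longleftrightarrow> arc_at P i (\<not> d) \<in> D"
  by (metis image_iff swap_arc_at swap_swap)

lemma source_iff:
  assumes o: "oriented D"
  shows "is_source G D u \<longleftrightarrow> (\<forall>P\<in>Ps. state D P 0 = Some True)"
    and "is_source G D v \<longleftrightarrow> (\<forall>P\<in>Ps. state D P (length P - 1) = Some False)"
    and "P \<in> Ps \<Longrightarrow> Suc i < length P \<Longrightarrow> is_source G D (vert P (Suc i)) \<longleftrightarrow>
      state D P i = Some False \<and> state D P (Suc i) = Some True"
proof -
  have l: "P \<in> Ps \<Longrightarrow> 0 < length P" for P using length_ge_2[of P] by auto
  have "P \<in> Ps \<Longrightarrow> \<exists>x. arc_at P 0 True = (u, x)" for P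
    using l vert_simps by (auto simp: arc_at_eq)
  then show "is_source G D u \<longleftrightarrow> (\<forall>P\<in>Ps. state D P 0 = Some True)"
    unfolding is_source_def out_arcs_u using state_eq_Some[OF o] l by metis
  have "P \<in> Ps \<Longrightarrow> \<exists>x. arc_at P (length P - 1) False = (v, x)" for P
    using l vert_simps by (auto simp: arc_at_eq)
  then show "is_source G D v \<longleftrightarrow> (\<forall>P\<in>Ps. state D P (length P - 1) = Some False)"
    unfolding is_source_def out_arcs_v using state_eq_Some[OF o] l
    by (metis diff_less zero_less_one)
  show "is_source G D (vert P (Suc i)) \<longleftrightarrow> state D P i = Some False \<and> state D P (Suc i) = Some True"
    if P: "P \<in> Ps" "Suc i < length P"
  proof -
    have "arc_at P i False = (vert P (Suc i), vert P i)" "arc_at P (Suc i) True = (vert P (Suc i), vert P (Suc (Suc i)))"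
      using P by (auto simp: arc_at_eq)
    then show ?thesis
      unfolding is_source_def out_arcs_inner[OF P] using state_eq_Some[OF o P(1)] P by auto
  qed
qed

text \<open>Reversing all arcs turns sinks into sources and negates every recorded direction, which
  reduces the claim to \<open>source_iff\<close>.\<close>

lemma sink_iff:
  assumes o: "oriented D"
  shows "is_sink G D u \<longleftrightarrow> (\<forall>P\<in>Ps. state D P 0 = Some False)"
    and "is_sink G D v \<longleftrightarrow> (\<forall>P\<in>Ps. state D P (length P - 1) = Some True)"
    and "P \<in> Ps \<Longrightarrow> Suc i < length P \<Longrightarrow> is_sink G D (vert P (Suc i)) \<longleftrightarrow>
      state D P i = Some True \<and> state D P (Suc i) = Some False"
proof -
  have sw: "state (prod.swap ` D) P i = Some d \<longleftrightarrow> state D P i = Some (\<not> d)"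
    if "P \<in> Ps" "i < length P" for P i d
    using state_eq_Some[OF _ that] o oriented_swap arc_at_swap by metis
  have l: "P \<in> Ps \<Longrightarrow> 0 < length P" for P using length_ge_2[of P] by auto
  note src = source_iff[of "prod.swap ` D", unfolded oriented_swap, OF o]
  show "is_sink G D u \<longleftrightarrow> (\<forall>P\<in>Ps. state D P 0 = Some False)"
    unfolding is_sink_iff_source src using sw l by simp
  show "is_sink G D v \<longleftrightarrow> (\<forall>P\<in>Ps. state D P (length P - 1) = Some True)"
    unfolding is_sink_iff_source src using sw l by simp
  show "is_sink G D (vert P (Suc i)) \<longleftrightarrow> state D P i = Some True \<and> state D P (Suc i) = Some False"
    if P: "P \<in> Ps" "Suc i < length P"
    unfolding is_sink_iff_source src(3)[OF P] using sw P by simp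
qed

lemma pverts_eq: "pverts G = (\<Union>P\<in>Ps. vert P ` {..length P})"
  using union set_verts unfolding union_of_disjoint_paths_def by auto

lemma valid_state_iff:
  assumes o: "oriented D"
  shows "valid (state D) \<longleftrightarrow> (\<forall>w\<in>pverts G. \<not> is_sink G D w \<and> \<not> is_source G D w)"
proof -
  have "(\<forall>w\<in>pverts G. R w) \<longleftrightarrow> R u \<and> R v \<and> (\<forall>P\<in>Ps. \<forall>i. Suc i < length P \<longrightarrow> R (vert P (Suc i)))" for R
  proof -
    have "w = u \<or> w = v \<or> (\<exists>P\<in>Ps. \<exists>i. Suc i < length P \<and> w = vert P (Suc i))" if w: "w \<in> pverts G" for w
    proof -
      obtain P k where P: "P \<in> Ps" "k \<le> length P" "w = vert P k" using w unfolding pverts_eq by auto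
      show ?thesis
      proof (cases "k = 0 \<or> k = length P")
        case True
        then show ?thesis using P vert_simps[OF P(1)] by auto
      next
        case False
        then obtain i where "k = Suc i" "Suc i < length P" using P(2) by (cases k) auto
        then show ?thesis using P by blast
      qed
    qed
    moreover have "u \<in> pverts G" "v \<in> pverts G"
    proof -
      obtain P where P: "P \<in> Ps" using Ps_nonempty by blast
      have "vert P 0 \<in> pverts G" "vert P (length P) \<in> pverts G" using P unfolding pverts_eq by auto
      then show "u \<in> pverts G" "v \<in> pverts G" using vert_simps[OF P] by simp_all
    qed
    moreover have "P \<in> Ps \<Longrightarrow> Suc i < length P \<Longrightarrow> vert P (Suc i) \<in> pverts G" for P i
      unfolding pverts_eq by (rule UN_I, assumption, rule imageI, simp)
    ultimately show ?thesis by metis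
  qed
  note all = this
  have inner: "(\<forall>P\<in>Ps. \<forall>i d. Suc i < length P \<longrightarrow> state D P i = Some d \<longrightarrow> state D P (Suc i) \<noteq> Some (\<not> d)) \<longleftrightarrow>
      (\<forall>P\<in>Ps. \<forall>i. Suc i < length P \<longrightarrow> \<not> is_sink G D (vert P (Suc i)) \<and> \<not> is_source G D (vert P (Suc i)))"
  proof (intro ball_cong refl iff_allI)
    fix P i assume P: "P \<in> Ps"
    show "(\<forall>d. Suc i < length P \<longrightarrow> state D P i = Some d \<longrightarrow> state D P (Suc i) \<noteq> Some (\<not> d)) \<longleftrightarrow>
        (Suc i < length P \<longrightarrow> \<not> is_sink G D (vert P (Suc i)) \<and> \<not> is_source G D (vert P (Suc i)))"
    proof (cases "Suc i < length P")
      case True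
      then show ?thesis
        unfolding sink_iff(3)[OF o P True] source_iff(3)[OF o P True] all_bool_eq by auto
    qed simp
  qed
  have outer: "(\<forall>b d. \<exists>P\<in>Ps. state D P (first_edge b P) \<noteq> Some d) \<longleftrightarrow>
      \<not> is_sink G D u \<and> \<not> is_source G D u \<and> \<not> is_sink G D v \<and> \<not> is_source G D v"
    unfolding sink_iff(1,2)[OF o] source_iff(1,2)[OF o] first_edge_def all_bool_eq if_True if_False
    by blast
  show ?thesis
    unfolding valid_def all outer inner by blast
qed

lemma oriented_insert:
  assumes "oriented D" "a \<in> parcs G" "prod.swap a \<notin> D"
  shows "oriented (insert a D)"
proof -
  have "prod.swap a \<noteq> a" using assms(2) no_loops' by (cases a) auto
  then show ?thesis using assms by (auto simp: oriented_def)
qed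

lemma legal_move_arc_at:
  assumes o: "oriented D" and P: "P \<in> Ps" "i < length P"
  shows "legal_move G D (arc_at P i d) \<longleftrightarrow> can_direct (state D) P i d"
proof (cases "state D P i = None")
  case True
  then have "arc_at P i d \<notin> D" "prod.swap (arc_at P i d) \<notin> D"
    using state_eq_None[OF P, of D d] by auto
  moreover have "oriented (insert (arc_at P i d) D)"
    using oriented_insert[OF o arc_at_in_arcs[OF P]] calculation by blast
  ultimately show ?thesis
    unfolding legal_move_def can_direct_def
    using P True arc_at_in_arcs[OF P] valid_state_iff[of "insert (arc_at P i d) D"] state_insert[OF P True]
    by simp
next
  case False
  then show ?thesis
    using state_eq_None[OF P, of D d] by (auto simp: legal_move_def can_direct_def)
qed

lemma oriented_legal: "oriented D \<Longrightarrow> legal_move G D a \<Longrightarrow> oriented (insert a D)"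
  using oriented_insert by (simp add: legal_move_def)

section \<open>Cells contain whole paths\<close>

lemma run_forward:
  assumes X: "X \<subseteq> parcs G" and next_arc: "\<And>a. a \<in> X \<Longrightarrow> \<exists>b\<in>X. fst b = snd a \<and> snd b \<noteq> fst a"
    and P: "P \<in> Ps" "i < length P" and a: "arc_at P i d \<in> X"
    and j: "j < length P" "if d then i \<le> j else j \<le> i"
  shows "arc_at P j d \<in> X"
proof -
  \<comment> \<open>At an inner vertex, of degree 2, the only continuation of an arc other than its
    reversal is the next arc of the path.\<close>
  have step_arc: "arc_at P (if d then Suc k else k - 1) d \<in> X"
    if k: "k < length P" "arc_at P k d \<in> X" "if d then Suc k < length P else 0 < k" for k
  proof -
    obtain b where b: "b \<in> X" "fst b = snd (arc_at P k d)" "snd b \<noteq> fst (arc_at P k d)"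
      using next_arc[OF k(2)] by blast
    \<comment> \<open>Chosen so that the head of \<open>arc_at P k d\<close> is the inner vertex
      with index \<open>Suc m\<close>, for either value of \<open>d\<close>.\<close>
    define m where "m = (if d then k else k - 1)"
    have m: "Suc m < length P" using k by (auto simp: m_def)
    have "fst b = vert P (Suc m)" using b(2) k P by (auto simp: arc_at_eq m_def split: if_splits)
    then have "b = arc_at P m False \<or> b = arc_at P (Suc m) True"
      using out_arcs_inner[OF P(1) m, of "snd b"] b(1) X by (cases b) auto
    moreover have "b \<noteq> arc_at P k (\<not> d)" using b(3) P k by (auto simp: arc_at_eq)
    ultimately show ?thesis using k b(1) by (auto simp: m_def split: if_splits)
  qed
  show ?thesis
  proof (cases d)
    case True
    then have "i \<le> j" using j by simp
    then show ?thesis using j(1)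
    proof (induction j rule: dec_induct)
      case (step n)
      then show ?case using step_arc[of n] True by simp
    qed (use a in simp)
  next
    case False
    then have "j \<le> i" using j by simp
    then show ?thesis
    proof (induction j rule: inc_induct)
      case (step n)
      then show ?case using step_arc[of "Suc n"] False P(2) by simp
    qed (use a in simp)
  qed
qed

lemma cycle_cellD:
  assumes c: "c \<in> cycle_cells G pos curve" and a: "a \<in> set c"
  shows "set c \<subseteq> parcs G" "\<exists>b\<in>set c. fst b = snd a \<and> snd b \<noteq> fst a"
    "\<exists>b\<in>set c. snd b = fst a \<and> fst b \<noteq> snd a"
proof -
  obtain w where w: "set c \<subseteq> parcs G" "pcas w c w" "distinct (tl (pawalk_verts w c))"
    and l: "3 \<le> length c"
    using c unfolding cycle_cells_def cycle_def awalk_def by auto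
  have "tl (pawalk_verts w c) = map snd c"
    using awalk_verts_conv'[OF w(2)] l by auto
  then have d: "distinct (map snd c)" using w by simp
  show "set c \<subseteq> parcs G" by fact
  show "\<exists>b\<in>set c. fst b = snd a \<and> snd b \<noteq> fst a" "\<exists>b\<in>set c. snd b = fst a \<and> fst b \<noteq> snd a"
    using closed_walk_neighbours[OF w(2) d l a] by auto
qed

text \<open>\<open>run_forward\<close> on the cell covers the part of the path that follows edge
  \<open>i\<close> in direction \<open>d\<close>; on the reversed cell it covers the part that
  precedes it.\<close>

lemma cell_contains_path:
  assumes c: "c \<in> cycle_cells G pos curve" and P: "P \<in> Ps" "i < length P" and a: "arc_at P i d \<in> set c"
    and j: "j < length P"
  shows "arc_at P j d \<in> set c"
proof -
  have sub: "set c \<subseteq> parcs G" using cycle_cellD(1)[OF c a] .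
  let ?X = "prod.swap ` set c"
  have "?X \<subseteq> parcs G" using sub arcs_symmetric by auto
  moreover have "\<exists>b\<in>?X. fst b = snd x \<and> snd b \<noteq> fst x" if "x \<in> ?X" for x
    using that cycle_cellD(3)[OF c] by force
  moreover have "arc_at P i (\<not> d) \<in> ?X" using a arc_at_swap by simp
  ultimately have "if d then j \<le> i else i \<le> j \<Longrightarrow> arc_at P j (\<not> d) \<in> ?X"
    using run_forward[of ?X P i "\<not> d" j] P j by auto
  moreover have "if d then i \<le> j else j \<le> i \<Longrightarrow> arc_at P j d \<in> set c"
    using run_forward[OF sub cycle_cellD(2)[OF c] P a j] by blast
  ultimately show ?thesis using arc_at_swap by (cases d) (auto, (meson nat_le_linear)+)
qed

text \<open>The cell leaves the end vertex reached by \<open>P\<close> along an arc that begins a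
  path in the opposite direction, and \<open>cell_contains_path\<close> supplies the rest of that
  path.\<close>

lemma cell_turns:
  assumes c: "c \<in> cycle_cells G pos curve" and P: "P \<in> Ps" and full: "\<And>j. j < length P \<Longrightarrow> arc_at P j d \<in> set c"
  shows "\<exists>Q\<in>Ps. \<forall>j<length Q. arc_at Q j (\<not> d) \<in> set c"
proof -
  have l: "Q \<in> Ps \<Longrightarrow> 0 < length Q" for Q using length_ge_2[of Q] by auto
  define a where "a = arc_at P (if d then length P - 1 else 0) d"
  have a: "a \<in> set c" using full l[OF P] by (simp add: a_def)
  have sa: "snd a = (if d then v else u)"
    using l[OF P] vert_simps[OF P] P by (auto simp: a_def arc_at_eq)
  obtain b where b: "b \<in> set c" "fst b = (if d then v else u)" using cycle_cellD(2)[OF c a] sa by auto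
  have "b \<in> parcs G" using b cycle_cellD(1)[OF c a] by blast
  then obtain Q where Q: "Q \<in> Ps" "b = arc_at Q (if d then length Q - 1 else 0) (\<not> d)"
    using out_arcs_u[of "snd b"] out_arcs_v[of "snd b"] b(2) by (cases b; cases d) auto
  have "(if d then length Q - 1 else 0) < length Q" using l[OF Q(1)] by simp
  then show ?thesis using cell_contains_path[OF c Q(1)] Q b(1) by blast
qed

text \<open>A cell completed by \<open>a\<close> contains \<open>a\<close>, hence the whole path of
  \<open>a\<close> and some whole path in the opposite direction; \<open>good_no_completion\<close>
  refutes this.\<close>

lemma good_no_cell_completed:
  assumes o: "oriented D" and g: "good (state D)" and n: "\<not> cell_completed (cycle_cells G pos curve) D"
    and lm: "legal_move G D a"
  shows "\<not> cell_completed (cycle_cells G pos curve) (insert a D)"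
proof
  assume "cell_completed (cycle_cells G pos curve) (insert a D)"
  then obtain c where c: "c \<in> cycle_cells G pos curve" "set c \<subseteq> insert a D"
    unfolding cell_completed_def by blast
  then have ac: "a \<in> set c" using n unfolding cell_completed_def by blast
  have "a \<in> parcs G" using lm by (simp add: legal_move_def)
  then obtain P i d where P: "P \<in> Ps" "i < length P" and a: "a = arc_at P i d" by (rule arcs_cases)
  have cd: "can_direct (state D) P i d" using lm legal_move_arc_at[OF o P] a by simp
  then have st: "state (insert a D) = direct (state D) P i d"
    using state_insert[OF P] a by (simp add: can_direct_def)
  have o': "oriented (insert a D)" using oriented_legal[OF o lm] .
  have full: "all_directed (direct (state D) P i d) Q e"
    if "Q \<in> Ps" "\<forall>j<length Q. arc_at Q j e \<in> set c" for Q e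
    using that c(2) state_eq_Some[OF o'] unfolding all_directed_def st by blast
  have P_in: "\<forall>j<length P. arc_at P j d \<in> set c" using cell_contains_path[OF c(1) P] ac a by blast
  then obtain Q where Q: "Q \<in> Ps" "\<forall>j<length Q. arc_at Q j (\<not> d) \<in> set c"
    using cell_turns[OF c(1) P(1)] by blast
  have "\<exists>R\<in>Ps. all_directed (direct (state D) P i d) R e" for e
    using full[OF P(1) P_in] full[OF Q] P(1) Q(1) by (cases "e = d") auto
  then show False using good_no_completion[OF g cd full[OF P(1) P_in]] by blast
qed

text \<open>For an odd number of edges the invariant is reached by the opening move of Player 1; for
  an even number it holds at the start, with Player 1 in the role of the opponent.\<close>

theorem winner_by_parity:
  "has_winning_strategy G (cycle_cells G pos curve) (if odd (card (uedges G)) then Player1 else Player2)"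
proof -
  let ?C = "cycle_cells G pos curve"
  have blank: "state {} = blank" by (auto simp: state_def fun_eq_iff)
  have o0: "oriented {}" by (simp add: oriented_def)
  have n0: "\<not> cell_completed ?C {}" by (auto simp: cell_completed_def cycle_cells_def)
  have move: "legal_move G D (arc_at P i d) \<and> oriented (insert (arc_at P i d) D) \<and>
      state (insert (arc_at P i d) D) = direct (state D) P i d"
    if "oriented D" "can_direct (state D) P i d" for D P i d
  proof -
    have P: "P \<in> Ps" "i < length P" "state D P i = None" using that(2) by (auto simp: can_direct_def)
    then have "legal_move G D (arc_at P i d)" using legal_move_arc_at that by blast
    then show ?thesis using oriented_legal[OF that(1)] state_insert[OF P] by blast
  qed
  show ?thesis
  proof (rule has_winning_strategy_from_invariant[where Inv = "\<lambda>D. oriented D \<and> good (state D)"])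
    show "if (if odd (card (uedges G)) then Player1 else Player2) = Player1
      then \<not> cell_completed ?C {} \<and> (\<exists>b. legal_move G {} b \<and> oriented (insert b {}) \<and> good (state (insert b {})))
      else oriented {} \<and> good (state {})"
    proof (cases "odd (card (uedges G))")
      case True
      then obtain P i d where "can_direct (state {}) P i d" "good (direct (state {}) P i d)"
        using good_first_move unfolding card_uedges blank by blast
      then show ?thesis using move[OF o0] n0 True by metis
    next
      case False
      then show ?thesis using good_blank[OF Ps_nonempty] o0 unfolding card_uedges blank by simp
    qed
  next
    fix D a
    assume inv: "oriented D \<and> good (state D)" and n: "\<not> game_over G ?C D" and lm: "legal_move G D a"
    then have o: "oriented D" and g: "good (state D)" and nc: "\<not> cell_completed ?C D"
      by (auto simp: game_over_def)
    have "a \<in> parcs G" using lm by (simp add: legal_move_def)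
    then obtain P i d where P: "P \<in> Ps" "i < length P" and a: "a = arc_at P i d" by (rule arcs_cases)
    have cd: "can_direct (state D) P i d" using lm legal_move_arc_at[OF o P] a by simp
    then have st: "state (insert a D) = direct (state D) P i d" and o': "oriented (insert a D)"
      using move[OF o cd] a by auto
    obtain Q j x where q: "can_direct (state (insert a D)) Q j x" "good (direct (state (insert a D)) Q j x)"
      using good_reply[OF g cd] unfolding st by blast
    show "\<not> cell_completed ?C (insert a D) \<and>
      (\<exists>b. legal_move G (insert a D) b \<and> oriented (insert b (insert a D)) \<and> good (state (insert b (insert a D))))"
      using good_no_cell_completed[OF o g nc lm] move[OF o' q(1)] q(2) by metis
  qed
qed

end

theorem theorem5:
  fixes G :: "'v pair_pre_digraph"
    and u v :: 'v
    and Ps :: "('v \<times> 'v) list set"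
    and pos :: "'v \<Rightarrow> complex"
    and curve :: "'v set \<Rightarrow> real \<Rightarrow> complex"
    and a :: real
  assumes "pair_graph G"
    and "Digraph_Component.connected (with_proj G)"
    and "union_of_disjoint_paths G u v Ps"
    and "plane_drawing G pos curve"
    and "\<forall>w\<in>pverts G - {u}. Re (pos u) < Re (pos w)"
    and "\<forall>w\<in>pverts G - {v}. Re (pos w) < Re (pos v)"
    and "symmetric_drawing a G pos curve"
    and "reflection a (pos u) = pos v"
    and "reflection a (pos v) = pos u"
    and "\<forall>P\<in>Ps. reflection a ` drawn_walk curve P = drawn_walk curve P"
    and "\<forall>P\<in>Ps. odd (length P) \<longrightarrow> 5 \<le> length P"
  shows "(odd (card (uedges G)) \<longrightarrow>
            has_winning_strategy G (cycle_cells G pos curve) Player1) \<and>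
         (even (card (uedges G)) \<longrightarrow>
            has_winning_strategy G (cycle_cells G pos curve) Player2)"
proof -
  interpret disjoint_paths G u v Ps
    using assms(1,3,11) by (intro disjoint_paths.intro disjoint_paths_axioms.intro) auto
  show ?thesis using winner_by_parity[of pos curve] by (cases "odd (card (uedges G))") simp_all
qed

end
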